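(* For every $d\geq 3$ there exist a finite-dimensional complex vector space $V$ and a form $F\in S^dV^*$ that is concise, of minimal border rank (i.e. $\underline{\mathbf r}(F)=\dim V$), and wild.
   Context: Let $\dim V=n+1$, and let $T=S^\bullet V$ act on $S^\bullet V^*$ by differentiation. For a nonzero form $F\in S^dV^*$, $\mathrm{Ann}(F)=\{h\in T:h\circ F=0\}$; $F$ is concise if $\mathrm{Ann}(F)$ contains no nonzero linear form. Let $X=\nu_d(\mathbb P^n)\subset\mathbb P(S^dV^* )$ be the Veronese variety of $d$-th powers $[L^d]$, $L\in V^*$. The border rank $\underline{\mathbf r}(F)$ is the least $r$ with $[F]\in\sigma_r(X)$, the $r$-th secant variety of $X$ (closure of the union of spans of $r$ points of $X$). The smoothable rank $\mathrm{sr}(F)$ is the least $r$ such that there is a zero-dimensional scheme $R\subset X$ of length $r$, smoothable in $X$ (a flat limit of reduced schemes of $r$ distinct points of $X$), with $[F]$ in the linear span of $R$. $F$ is wild if $\mathrm{sr}(F)>\underline{\mathbf r}(F)$. *)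

theory Defs
  imports
    Complex_Main
    "HOL-Library.Poly_Mapping"
    "HOL-Library.Extended_Nat"
    "HOL-Computational_Algebra.Formal_Power_Series"
begin

section \<open>Polynomials in the variables \<open>x\<^sub>0, \<dots>, x\<^bsub>N-1\<^esub>\<close>\<close>

type_synonym ('v, 'a) mpoly = "('v \<Rightarrow>\<^sub>0 nat) \<Rightarrow>\<^sub>0 'a"

definition const :: "'a::zero \<Rightarrow> ('v, 'a) mpoly" where
  "const c = Poly_Mapping.single 0 c"

definition mon_degree :: "('v \<Rightarrow>\<^sub>0 nat) \<Rightarrow> nat" where
  "mon_degree m = (\<Sum>v\<in>Poly_Mapping.keys m. Poly_Mapping.lookup m v)"

definition homogeneous :: "nat \<Rightarrow> ('v, 'a::zero) mpoly \<Rightarrow> bool" where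
  "homogeneous k p \<longleftrightarrow> (\<forall>m\<in>Poly_Mapping.keys p. mon_degree m = k)"

definition homogeneous_component :: "nat \<Rightarrow> ('v, 'a::comm_monoid_add) mpoly \<Rightarrow> ('v, 'a) mpoly" where
  "homogeneous_component k p =
     (\<Sum>m\<in>{m \<in> Poly_Mapping.keys p. mon_degree m = k}.
        Poly_Mapping.single m (Poly_Mapping.lookup p m))"

definition poly_value :: "('v \<Rightarrow> 'a) \<Rightarrow> ('v, 'a::comm_semiring_1) mpoly \<Rightarrow> 'a" where
  "poly_value a p =
     (\<Sum>m\<in>Poly_Mapping.keys p. Poly_Mapping.lookup p m *
        (\<Prod>v\<in>Poly_Mapping.keys m. a v ^ Poly_Mapping.lookup m v))"

definition polys :: "nat \<Rightarrow> (nat, 'a::zero) mpoly set" where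
  "polys N = {p. \<forall>m\<in>Poly_Mapping.keys p. Poly_Mapping.keys m \<subseteq> {..<N}}"

text \<open>
  With \<open>V = \<complex>\<^sup>N\<close>, the set \<open>polys N\<close> over \<open>\<complex>\<close> serves both as \<open>S\<^sup>\<bullet>V\<^sup>*\<close> and as
  \<open>T = S\<^sup>\<bullet>V\<close>, in dual bases. The projective space \<open>\<bbbP>(V\<^sup>*)\<close> of linear forms \<open>[L]\<close> has
  homogeneous coordinate ring \<open>T\<close>.
\<close>

definition forms :: "nat \<Rightarrow> nat \<Rightarrow> (nat, 'a::zero) mpoly set" where
  "forms N k = {p \<in> polys N. homogeneous k p}"

interpretation mpoly_vs: vector_space "\<lambda>(c::complex) (p::(nat, complex) mpoly). const c * p"
  by unfold_locales
     (simp_all add: const_def algebra_simps single_add mult_single flip: mult.assoc)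


section \<open>Apolarity and conciseness\<close>

text \<open>
  \<open>\<partial>\<^sup>\<alpha> x\<^sup>\<beta> = (\<Prod>\<^sub>i \<beta>\<^sub>i! / (\<beta>\<^sub>i - \<alpha>\<^sub>i)!) x\<^bsup>\<beta>-\<alpha>\<^esup>\<close>. The falling factorial is
  written \<open>(\<beta>\<^sub>i choose \<alpha>\<^sub>i) \<alpha>\<^sub>i!\<close>, which is \<open>0\<close> if \<open>\<alpha>\<^sub>i > \<beta>\<^sub>i\<close>; the truncated
  difference of exponents is then irrelevant.
\<close>

definition apply_diff :: "(nat, complex) mpoly \<Rightarrow> (nat, complex) mpoly \<Rightarrow> (nat, complex) mpoly" where
  "apply_diff h F =
     (\<Sum>\<alpha>\<in>Poly_Mapping.keys h. \<Sum>\<beta>\<in>Poly_Mapping.keys F.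
        Poly_Mapping.single (\<beta> - \<alpha>)
          (Poly_Mapping.lookup h \<alpha> * Poly_Mapping.lookup F \<beta> *
           (\<Prod>i\<in>Poly_Mapping.keys \<alpha>.
              of_nat ((Poly_Mapping.lookup \<beta> i choose Poly_Mapping.lookup \<alpha> i) *
                      fact (Poly_Mapping.lookup \<alpha> i)))))"

definition Ann :: "nat \<Rightarrow> (nat, complex) mpoly \<Rightarrow> (nat, complex) mpoly set" where
  "Ann N F = {h \<in> polys N. apply_diff h F = 0}"

definition concise :: "nat \<Rightarrow> (nat, complex) mpoly \<Rightarrow> bool" where
  "concise N F \<longleftrightarrow> (\<forall>h \<in> Ann N F \<inter> forms N 1. h = 0)"


section \<open>Secant varieties of the Veronese variety and border rank\<close>

text \<open>
  A subset of \<open>\<bbbP>(S\<^sup>dV\<^sup>*)\<close> is represented by the set of all nonzero vectors \<open>G\<close> that represent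
  its points \<open>[G]\<close>.
\<close>

definition veronese_spans :: "nat \<Rightarrow> nat \<Rightarrow> nat \<Rightarrow> (nat, complex) mpoly set" where
  "veronese_spans N d r =
     {G. G \<noteq> 0 \<and> (\<exists>L c. (\<forall>i<r. L i \<in> forms N 1 \<and> L i \<noteq> 0) \<and>
                       G = (\<Sum>i<r. const (c i) * L i ^ d))}"

text \<open>
  Zariski closure in \<open>\<bbbP>(S\<^sup>dV\<^sup>*)\<close>. The homogeneous coordinates of \<open>[G]\<close> are the coefficients
  of \<open>G\<close>, so the variables of \<open>P\<close> are indexed by monomials; variables belonging to monomials
  outside \<open>S\<^sup>dV\<^sup>*\<close> take the value \<open>0\<close>.
\<close>

definition proj_closure ::
    "nat \<Rightarrow> nat \<Rightarrow> (nat, complex) mpoly set \<Rightarrow> (nat, complex) mpoly set" where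
  "proj_closure N d Y =
     {G \<in> forms N d - {0}. \<forall>(P :: (nat \<Rightarrow>\<^sub>0 nat, complex) mpoly) k.
        homogeneous k P \<longrightarrow> (\<forall>H\<in>Y. poly_value (Poly_Mapping.lookup H) P = 0) \<longrightarrow>
        poly_value (Poly_Mapping.lookup G) P = 0}"

definition secant_variety :: "nat \<Rightarrow> nat \<Rightarrow> nat \<Rightarrow> (nat, complex) mpoly set" where
  "secant_variety N d r = proj_closure N d (veronese_spans N d r)"

text \<open>
  The least element, read as \<open>\<infinity>\<close> if there is none. For a nonzero \<open>F \<in> S\<^sup>dV\<^sup>*\<close> with
  \<open>d \<ge> 1\<close> this does not occur below, because \<open>S\<^sup>dV\<^sup>*\<close> is spanned by \<open>d\<close>-th powers.
\<close>

definition least_rank :: "(nat \<Rightarrow> bool) \<Rightarrow> enat" where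
  "least_rank P = Inf (enat ` {r. P r})"

definition border_rank :: "nat \<Rightarrow> nat \<Rightarrow> (nat, complex) mpoly \<Rightarrow> enat" where
  "border_rank N d F = least_rank (\<lambda>r. F \<in> secant_variety N d r)"


section \<open>Zero-dimensional schemes and their smoothability\<close>

definition homogeneous_ideal :: "nat \<Rightarrow> (nat, 'a::comm_ring_1) mpoly set \<Rightarrow> bool" where
  "homogeneous_ideal N I \<longleftrightarrow>
     I \<subseteq> polys N \<and> 0 \<in> I \<and>
     (\<forall>p\<in>I. \<forall>q\<in>I. p + q \<in> I) \<and>
     (\<forall>h\<in>polys N. \<forall>p\<in>I. h * p \<in> I) \<and>
     (\<forall>p\<in>I. \<forall>k. homogeneous_component k p \<in> I)"

text \<open>Saturation with respect to the irrelevant ideal.\<close>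

definition saturation :: "nat \<Rightarrow> (nat, 'a::comm_ring_1) mpoly set \<Rightarrow> (nat, 'a) mpoly set" where
  "saturation N I = {h \<in> polys N. \<exists>k. \<forall>g\<in>forms N k. g * h \<in> I}"

text \<open>
  Closed subschemes of \<open>\<bbbP>(V\<^sup>*)\<close>, which is identified with the Veronese variety
  \<open>X \<subseteq> \<bbbP>(S\<^sup>dV\<^sup>*)\<close> via \<open>[L] \<mapsto> [L\<^sup>d]\<close>, correspond to saturated homogeneous ideals of \<open>T\<close>.
  Such a scheme is zero-dimensional of length \<open>r\<close> (empty for \<open>r = 0\<close>) iff its Hilbert
  polynomial is the constant \<open>r\<close>.
\<close>

definition zero_dim_scheme :: "nat \<Rightarrow> nat \<Rightarrow> (nat, complex) mpoly set \<Rightarrow> bool" where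
  "zero_dim_scheme N r I \<longleftrightarrow>
     homogeneous_ideal N I \<and> saturation N I = I \<and>
     (\<exists>k0. \<forall>k\<ge>k0. mpoly_vs.dim (forms N k) = mpoly_vs.dim (I \<inter> forms N k) + r)"

text \<open>
  A hyperplane of \<open>\<bbbP>(S\<^sup>dV\<^sup>*)\<close> is given by some \<open>h \<in> T\<^sub>d\<close>, through the pairing
  \<open>(h, G) \<mapsto> h \<circ> G\<close>. Since \<open>h \<circ> L\<^sup>d = d! h(L)\<close>, it contains the scheme \<open>\<nu>\<^sub>d(R)\<close> iff \<open>h\<close> lies
  in the saturated ideal of \<open>R\<close>. The span is the intersection of these hyperplanes.
\<close>

definition linear_span :: "nat \<Rightarrow> nat \<Rightarrow> (nat, complex) mpoly set \<Rightarrow> (nat, complex) mpoly set" where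
  "linear_span N d I = {G \<in> forms N d - {0}. \<forall>h \<in> I \<inter> forms N d. apply_diff h G = 0}"

text \<open>
  Homogeneous ideals \<open>J\<close> of \<open>\<complex>\<lbrakk>t\<rbrakk>[x\<^sub>0, \<dots>, x\<^bsub>N-1\<^esub>]\<close> define closed subschemes of
  \<open>\<bbbP>(V\<^sup>*) \<times> Spec \<complex>\<lbrakk>t\<rbrakk>\<close>. Over this discrete valuation ring, flat means \<open>t\<close>-torsion-free.
  If \<open>J\<close> is \<open>t\<close>-torsion-free then it is radical iff its extension to \<open>\<complex>((t))\<close> is, that is, the
  generic fibre is reduced. By flatness the generic fibre has the same length \<open>r\<close> as the special
  fibre, so (in characteristic \<open>0\<close>) it is geometrically a set of \<open>r\<close> distinct points.
\<close>

definition flat_family :: "nat \<Rightarrow> (nat, complex fps) mpoly set \<Rightarrow> bool" where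
  "flat_family N J \<longleftrightarrow>
     homogeneous_ideal N J \<and> (\<forall>h\<in>polys N. const fps_X * h \<in> J \<longrightarrow> h \<in> J)"

definition generically_reduced :: "nat \<Rightarrow> (nat, complex fps) mpoly set \<Rightarrow> bool" where
  "generically_reduced N J \<longleftrightarrow> (\<forall>h\<in>polys N. \<forall>m. h ^ m \<in> J \<longrightarrow> h \<in> J)"

definition special_fibre :: "nat \<Rightarrow> (nat, complex fps) mpoly set \<Rightarrow> (nat, complex) mpoly set" where
  "special_fibre N J = saturation N (Poly_Mapping.map (\<lambda>c. fps_nth c 0) ` J)"

definition smoothable :: "nat \<Rightarrow> (nat, complex) mpoly set \<Rightarrow> bool" where
  "smoothable N I \<longleftrightarrow>
     (\<exists>J. flat_family N J \<and> generically_reduced N J \<and> special_fibre N J = I)"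

definition smoothable_rank :: "nat \<Rightarrow> nat \<Rightarrow> (nat, complex) mpoly \<Rightarrow> enat" where
  "smoothable_rank N d F =
     least_rank (\<lambda>r. \<exists>I. zero_dim_scheme N r I \<and> smoothable N I \<and> F \<in> linear_span N d I)"

definition wild :: "nat \<Rightarrow> nat \<Rightarrow> (nat, complex) mpoly \<Rightarrow> bool" where
  "wild N d F \<longleftrightarrow> smoothable_rank N d F > border_rank N d F"

end

theory Submission
  imports Defs "HOL-Computational_Algebra.Polynomial" "Jordan_Normal_Form.Determinant"
begin

text \<open>
  Take \<open>N = d + 2\<close> variables \<open>x\<^sub>0, \<dots>, x\<^bsub>d-1\<^esub>, u, v\<close> and \<open>F = \<Sum>\<^sub>k x\<^sub>k u\<^sup>k v\<^bsup>d-1-k\<^esup> / (k! (d-1-k)!)\<close>.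
  The first catalecticant of \<open>F\<close> has full rank \<open>N\<close>, which gives conciseness and border rank at
  least \<open>N\<close>. For a primitive \<open>d\<close>-th root of unity \<open>\<omega>\<close> and \<open>L\<^sub>i = u + \<omega>\<^sup>i v\<close>, \<open>i < d\<close>, one has
  \<open>F = d \<Sum>\<^sub>i X\<^sub>i L\<^sub>i\<^bsup>d-1\<^esup>\<close> with linear forms \<open>X\<^sub>i\<close> in the \<open>x\<^sub>k\<close>, and
  \<open>\<Sum>\<^sub>i L\<^sub>i\<^sup>d = d (u\<^sup>d + v\<^sup>d)\<close>; therefore \<open>F\<close> is the limit of
  \<open>(\<Sum>\<^sub>i (L\<^sub>i + \<epsilon> X\<^sub>i)\<^sup>d - d u\<^sup>d - d v\<^sup>d) / \<epsilon>\<close> as \<open>\<epsilon> \<rightarrow> 0\<close>, and its border rank is at most \<open>N\<close>.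

  No zero-dimensional scheme of length \<open>r \<le> N\<close>, smoothable or not, contains \<open>F\<close> in its span.
  Otherwise its ideal \<open>I\<close> has \<open>I\<^sub>1 = 0\<close> as \<open>F\<close> is concise, and a generic linear form \<open>\<ell>\<close> is a
  nonzerodivisor modulo \<open>I\<close>, so that \<open>T\<^bsub>d-1\<^esub> = \<ell>\<^bsup>d-2\<^esup> T\<^sub>1 + I\<^bsub>d-1\<^esub>\<close> by counting dimensions.
  Because the Hessian of \<open>F\<close> vanishes, there is a nonzero linear form \<open>h\<close> with
  \<open>(\<ell> h) \<circ> F = 0\<close>; then \<open>h T\<^bsub>d-1\<^esub>\<close> annihilates \<open>F\<close>, against conciseness. The generic form is
  realized as \<open>\<ell> = \<Sum>\<^sub>i x\<^sub>i t\<^sup>i\<close> over \<open>T[t]\<close>.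
\<close>

abbreviation lookup where "lookup \<equiv> Poly_Mapping.lookup"
abbreviation keys where "keys \<equiv> Poly_Mapping.keys"
abbreviation single where "single \<equiv> Poly_Mapping.single"

section \<open>Polynomials and forms\<close>

abbreviation unit_exp :: "'v \<Rightarrow> ('v \<Rightarrow>\<^sub>0 nat)" where
  "unit_exp i \<equiv> single i (Suc 0)"

definition Var :: "'v \<Rightarrow> ('v, 'a::{zero,one}) mpoly" where
  "Var i = single (unit_exp i) 1"

lemma mpoly_expand:
  fixes p :: "('b, 'a::comm_monoid_add) poly_mapping"
  shows "p = (\<Sum>m\<in>keys p. single m (lookup p m))"
  by (rule poly_mapping_eqI) (simp add: lookup_sum lookup_single when_def sum.delta in_keys_iff)

lemma lookup_mult_single:
  fixes q :: "('v, 'a::semiring_0) mpoly"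
  shows "lookup (single a c * q) m = (\<Sum>k\<in>keys q. c * lookup q k when a + k = m)"
proof -
  have "single a c * q = single a c * (\<Sum>k\<in>keys q. single k (lookup q k))"
    using mpoly_expand[of q] by simp
  also have "\<dots> = (\<Sum>k\<in>keys q. single (a + k) (c * lookup q k))"
    by (simp add: sum_distrib_left mult_single)
  finally show ?thesis
    by (simp add: lookup_sum lookup_single)
qed

lemma lookup_mult_single_add [simp]:
  fixes q :: "('v, 'a::semiring_0) mpoly"
  shows "lookup (single a c * q) (a + b) = c * lookup q b"
  by (simp add: lookup_mult_single when_def in_keys_iff)

lemma lookup_mult_single_0:
  fixes q :: "('v, 'a::semiring_0) mpoly"
  assumes "\<And>b. m \<noteq> a + b"
  shows "lookup (single a c * q) m = 0"
  unfolding lookup_mult_single by (rule sum.neutral) (use assms in \<open>auto simp: when_def\<close>)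

lemma lookup_const_mult [simp]:
  fixes p :: "('v, 'a::semiring_0) mpoly"
  shows "lookup (const c * p) m = c * lookup p m"
  using lookup_mult_single_add[of 0 c p m] by (simp add: const_def)

lemma unit_exp_factor:
  assumes "lookup m i > 0"
  obtains b where "m = unit_exp i + b"
proof
  show "m = unit_exp i + (m - unit_exp i)"
    using assms by (intro poly_mapping_eqI) (auto simp: lookup_add lookup_minus lookup_single when_def)
qed

lemma mon_degree_altdef:
  assumes "finite A" "keys m \<subseteq> A"
  shows "mon_degree m = (\<Sum>v\<in>A. lookup m v)"
  unfolding mon_degree_def
  by (rule sum.mono_neutral_left) (use assms in \<open>auto simp: in_keys_iff\<close>)

lemma mon_degree_add: "mon_degree (a + b) = mon_degree a + mon_degree b"
proof -
  let ?A = "keys a \<union> keys b"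
  have "keys (a + b) \<subseteq> ?A" by (rule Poly_Mapping.keys_add)
  then show ?thesis
    using mon_degree_altdef[of ?A a] mon_degree_altdef[of ?A b] mon_degree_altdef[of ?A "a + b"]
    by (simp add: lookup_add sum.distrib)
qed

lemma mon_degree_single [simp]: "mon_degree (single i n) = n"
  by (simp add: mon_degree_def)

lemma mon_degree_0 [simp]: "mon_degree 0 = 0"
  by (simp add: mon_degree_def)

lemma mon_degree_sum: "mon_degree (\<Sum>i\<in>A. f i) = (\<Sum>i\<in>A. mon_degree (f i))"
  by (induction A rule: infinite_finite_induct) (auto simp: mon_degree_add)

lemma mon_degree_eq_0_iff: "mon_degree m = 0 \<longleftrightarrow> m = 0"
  by (auto simp: mon_degree_def in_keys_iff intro!: poly_mapping_eqI)

lemma formsI: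
  assumes "\<And>m. lookup p m \<noteq> 0 \<Longrightarrow> keys m \<subseteq> {..<N} \<and> mon_degree m = k"
  shows "p \<in> forms N k"
  using assms by (auto simp: forms_def polys_def homogeneous_def in_keys_iff)

lemma formsD:
  assumes "p \<in> forms N k" "lookup p m \<noteq> 0"
  shows "keys m \<subseteq> {..<N}" "mon_degree m = k"
  using assms by (auto simp: forms_def polys_def homogeneous_def in_keys_iff)

lemma forms_0 [simp]: "0 \<in> forms N k"
  by (rule formsI) auto

lemma forms_add: "p \<in> forms N k \<Longrightarrow> q \<in> forms N k \<Longrightarrow> p + q \<in> forms N k"
  for p q :: "(nat, 'a::monoid_add) mpoly"
  by (rule formsI) (metis add.right_neutral formsD lookup_add)

lemma forms_sum:
  "(\<And>i. i \<in> A \<Longrightarrow> f i \<in> forms N k) \<Longrightarrow> (\<Sum>i\<in>A. f i) \<in> forms N k"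
  for f :: "'i \<Rightarrow> (nat, 'a::comm_monoid_add) mpoly"
  by (induction A rule: infinite_finite_induct) (auto intro: forms_add)

lemma forms_single: "keys m \<subseteq> {..<N} \<Longrightarrow> mon_degree m = k \<Longrightarrow> single m c \<in> forms N k"
  by (rule formsI) (auto simp: lookup_single when_def split: if_splits)

lemma forms_Var: "i < N \<Longrightarrow> Var i \<in> forms N 1"
  unfolding Var_def by (rule forms_single) auto

lemma forms_mult:
  fixes p q :: "(nat, 'a::comm_semiring_0) mpoly"
  assumes "p \<in> forms N a" "q \<in> forms N b"
  shows "p * q \<in> forms N (a + b)"
proof (rule formsI)
  fix m assume "lookup (p * q) m \<noteq> 0"
  then have "m \<in> keys (p * q)" by (simp add: in_keys_iff)
  then obtain u v where uv: "m = u + v" "u \<in> keys p" "v \<in> keys q"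
    using keys_mult[of p q] by auto
  then show "keys m \<subseteq> {..<N} \<and> mon_degree m = a + b"
    using formsD[OF assms(1), of u] formsD[OF assms(2), of v] Poly_Mapping.keys_add[of u v]
    by (auto simp: in_keys_iff mon_degree_add)
qed

lemma forms_const: "const c \<in> forms N 0"
  unfolding const_def by (rule forms_single) auto

lemma forms_const_mult: "p \<in> forms N k \<Longrightarrow> const c * p \<in> forms N k"
  for p :: "(nat, 'a::comm_semiring_0) mpoly"
  using forms_mult[OF forms_const] by fastforce

lemma forms_polys: "p \<in> forms N k \<Longrightarrow> p \<in> polys N"
  by (simp add: forms_def)

lemma mon_degree_1E:
  assumes "mon_degree m = 1"
  obtains i where "m = unit_exp i"
proof -
  have "m \<noteq> 0" using assms by auto
  then obtain i where "lookup m i > 0" 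
    by (metis lookup_zero neq0_conv poly_mapping_eqI)
  then obtain b where b: "m = unit_exp i + b" by (rule unit_exp_factor)
  with assms have "b = 0" by (simp add: mon_degree_add mon_degree_eq_0_iff)
  with b that show thesis by auto
qed

lemma lookup_Var: "lookup (Var j) m = (if m = unit_exp j then 1 else 0)"
  by (auto simp: Var_def lookup_single when_def)

lemma linear_form_expand:
  fixes L :: "(nat, 'a::comm_semiring_1) mpoly"
  assumes L: "L \<in> forms N 1"
  shows "L = (\<Sum>j<N. const (lookup L (unit_exp j)) * Var j)"
proof (rule poly_mapping_eqI)
  fix m :: "nat \<Rightarrow>\<^sub>0 nat"
  have "lookup L m = (\<Sum>j<N. lookup L (unit_exp j) * lookup (Var j) m)"
  proof (cases "\<exists>i<N. m = unit_exp i")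
    case True
    then obtain i where i: "i < N" "m = unit_exp i" by auto
    have "(unit_exp i = unit_exp j) = (j = i)" for j
      by (metis lookup_single_eq lookup_single_not_eq nat.distinct(1))
    then have "(\<Sum>j<N. lookup L (unit_exp j) * lookup (Var j) m)
                 = (\<Sum>j<N. if j = i then lookup L m else 0)"
      unfolding i(2) by (intro sum.cong) (auto simp: lookup_Var)
    also have "\<dots> = lookup L m" using i(1) by (simp only: sum.delta finite_lessThan lessThan_iff if_True)
    finally show ?thesis by (rule sym)
  next
    case False
    have "lookup L m = 0"
    proof (rule ccontr)
      assume m: "lookup L m \<noteq> 0"
      from formsD(2)[OF L m] obtain i where "m = unit_exp i" by (rule mon_degree_1E)
      with formsD(1)[OF L m] False show False by auto
    qed
    moreover have "(\<Sum>j<N. lookup L (unit_exp j) * lookup (Var j) m) = 0"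
      by (rule sum.neutral) (use False in \<open>auto simp: lookup_Var\<close>)
    ultimately show ?thesis by (rule trans[OF _ sym])
  qed
  also have "\<dots> = lookup (\<Sum>j<N. const (lookup L (unit_exp j)) * Var j) m"
    by (simp only: lookup_sum lookup_const_mult)
  finally show "lookup L m = lookup (\<Sum>j<N. const (lookup L (unit_exp j)) * Var j) m" .
qed

lemma const_add: "const (a + b) = (const a + const b :: ('v, 'a::monoid_add) mpoly)"
  by (simp add: const_def single_add)

lemma const_0 [simp]: "const 0 = 0"
  by (simp add: const_def)

lemma const_1 [simp]: "const 1 = 1"
  by (simp add: const_def)

lemma const_mult: "const (a * b) = (const a * const b :: ('v, 'a::semiring_0) mpoly)"
  by (simp add: const_def mult_single)

lemma const_power: "const (a ^ n) = (const a ^ n :: ('v, 'a::semiring_1) mpoly)"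
  by (induction n) (simp_all add: const_mult)

lemma const_sum: "const (\<Sum>i\<in>A. f i) = (\<Sum>i\<in>A. const (f i) :: ('v, 'a::comm_monoid_add) mpoly)"
  by (induction A rule: infinite_finite_induct) (simp_all add: const_add)

lemma const_of_nat: "const (of_nat n) = (of_nat n :: ('v, 'a::semiring_1) mpoly)"
  by (induction n) (simp_all add: const_add)

lemma const_minus: "const (- a) = (- const a :: ('v, 'a::ab_group_add) mpoly)"
  by (simp add: const_def single_uminus)

lemma lookup_Var_mult_0:
  fixes p :: "(nat, 'a::semiring_1) mpoly"
  shows "lookup m j = 0 \<Longrightarrow> lookup (Var j * p) m = 0"
  unfolding Var_def by (rule lookup_mult_single_0) (auto simp: lookup_add)

lemma in_polys_iff: "p \<in> polys N \<longleftrightarrow> (\<forall>m. lookup p m \<noteq> 0 \<longrightarrow> keys m \<subseteq> {..<N})"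
  by (auto simp: polys_def in_keys_iff)

lemma polys_mult:
  fixes p q :: "(nat, 'a::comm_semiring_0) mpoly"
  assumes "p \<in> polys N" "q \<in> polys N"
  shows "p * q \<in> polys N"
proof -
  have "keys m \<subseteq> {..<N}" if m: "m \<in> keys (p * q)" for m
  proof -
    obtain u v where uv: "m = u + v" "u \<in> keys p" "v \<in> keys q"
      using keys_mult[of p q] m by blast
    from uv(2,3) have "keys u \<subseteq> {..<N}" "keys v \<subseteq> {..<N}"
      using assms by (simp_all add: polys_def)
    then show ?thesis
      using Poly_Mapping.keys_add[of u v] uv(1) by blast
  qed
  then show ?thesis by (auto simp: polys_def)
qed

lemma polys_uminus: "p \<in> polys N \<Longrightarrow> - p \<in> polys N"
  for p :: "(nat, 'a::ab_group_add) mpoly"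
  by (simp add: in_polys_iff)

lemma polys_add: "p \<in> polys N \<Longrightarrow> q \<in> polys N \<Longrightarrow> p + q \<in> polys N"
  for p q :: "(nat, 'a::comm_monoid_add) mpoly"
  unfolding polys_def using Poly_Mapping.keys_add[of p q] by blast

lemma polys_0: "0 \<in> polys N"
  by (simp add: polys_def)

lemma polys_sum: "(\<And>i. i \<in> A \<Longrightarrow> f i \<in> polys N) \<Longrightarrow> (\<Sum>i\<in>A. f i) \<in> polys N"
  for f :: "'i \<Rightarrow> (nat, 'a::comm_monoid_add) mpoly"
  by (induction A rule: infinite_finite_induct) (auto intro: polys_add polys_0)

lemma polys_1: "(1 :: (nat, 'a::zero_neq_one) mpoly) \<in> polys N"
  by (auto simp: in_polys_iff lookup_one when_def)

section \<open>Closure properties of homogeneous ideals\<close>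

context
  fixes N :: nat and I :: "(nat, 'a::comm_ring_1) mpoly set"
  assumes I: "homogeneous_ideal N I"
begin

lemma ideal_polys: "p \<in> I \<Longrightarrow> p \<in> polys N"
  using I by (auto simp: homogeneous_ideal_def)

lemma ideal_0: "0 \<in> I"
  using I by (auto simp: homogeneous_ideal_def)

lemma ideal_add: "p \<in> I \<Longrightarrow> q \<in> I \<Longrightarrow> p + q \<in> I"
  using I by (auto simp: homogeneous_ideal_def)

lemma ideal_mult: "h \<in> polys N \<Longrightarrow> p \<in> I \<Longrightarrow> h * p \<in> I"
  using I by (auto simp: homogeneous_ideal_def)

lemma ideal_diff: "p \<in> I \<Longrightarrow> q \<in> I \<Longrightarrow> p - q \<in> I"
  using ideal_add[of p "-1 * q"] ideal_mult[OF polys_uminus[OF polys_1], of q] by simp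

lemma ideal_sum: "(\<And>i. i \<in> A \<Longrightarrow> f i \<in> I) \<Longrightarrow> (\<Sum>i\<in>A. f i) \<in> I"
  by (induction A rule: infinite_finite_induct) (auto intro: ideal_add ideal_0)

end

section \<open>A generic linear form is a nonzerodivisor\<close>

text \<open>Membership in \<open>A[t]\<close> for a bare set \<open>A\<close>: this is
  \<open>T_k[t]\<close> when \<open>A\<close> is \<open>forms N k\<close>, and the extended ideal
  \<open>I[t]\<close> when \<open>A\<close> is \<open>I\<close>.\<close>

definition coeffs_in :: "'a::zero set \<Rightarrow> 'a poly \<Rightarrow> bool" where
  "coeffs_in A p \<longleftrightarrow> (\<forall>n. coeff p n \<in> A)"

lemma coeffs_in_forms_mult:
  fixes p q :: "(nat, 'a::comm_semiring_0) mpoly poly"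
  assumes "coeffs_in (forms N a) p" "coeffs_in (forms N b) q"
  shows "coeffs_in (forms N (a + b)) (p * q)"
  using assms by (auto simp: coeffs_in_def coeff_mult intro!: forms_sum forms_mult)

lemma coeffs_in_forms_power:
  fixes p :: "(nat, 'a::comm_semiring_1) mpoly poly"
  assumes "coeffs_in (forms N a) p"
  shows "coeffs_in (forms N (n * a)) (p ^ n)"
proof (induction n)
  case 0
  show ?case
    using forms_const[of "1::'a" N] by (auto simp: coeffs_in_def const_def)
next
  case (Suc n)
  then show ?case using coeffs_in_forms_mult[OF assms] by simp
qed

lemma coeffs_in_forms_polys: "coeffs_in (forms N k) p \<Longrightarrow> coeffs_in (polys N) p"
  by (auto simp: coeffs_in_def intro: forms_polys)

lemma coeffs_in_polys_mult:
  fixes p q :: "(nat, 'a::comm_semiring_0) mpoly poly"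
  assumes "coeffs_in (polys N) p" "coeffs_in (polys N) q"
  shows "coeffs_in (polys N) (p * q)"
  using assms by (auto simp: coeffs_in_def coeff_mult intro!: polys_sum polys_mult)

lemma coeffs_in_ideal_mult:
  assumes "homogeneous_ideal N I" "coeffs_in (polys N) p" "coeffs_in I q"
  shows "coeffs_in I (p * q)"
  using assms
  by (auto simp: coeffs_in_def coeff_mult intro!: ideal_sum[OF assms(1)] ideal_mult[OF assms(1)])

text \<open>Distinct powers of one parameter \<open>t\<close> act as general coefficients, in place
  of choosing a linear form that misses every point of the scheme.\<close>

definition generic_linear :: "nat \<Rightarrow> (nat, 'a::comm_ring_1) mpoly poly" where
  "generic_linear N = (\<Sum>i<N. monom (Var i) i)"

lemma coeff_generic_linear: "coeff (generic_linear N) n = (if n < N then Var n else 0)"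
  by (simp add: generic_linear_def coeff_sum sum.delta)

lemma generic_linear_forms: "coeffs_in (forms N 1) (generic_linear N)"
  by (simp add: coeffs_in_def coeff_generic_linear forms_Var[simplified])

lemma coeff_generic_linear_mult:
  "coeff (generic_linear N * p) n = (\<Sum>i<N. if i \<le> n then Var i * coeff p (n - i) else 0)"
  by (auto simp: generic_linear_def sum_distrib_right coeff_sum coeff_monom_mult intro!: sum.cong)

text \<open>
  McCoy's argument, by induction on the degree \<open>n\<close> of \<open>p\<close> with leading coefficient \<open>c\<close>: if
  \<open>x\<^sub>i c \<in> I\<close>, then \<open>x\<^sub>i p\<close> minus its top term has smaller degree, whence \<open>x\<^sub>i p \<in> I[t]\<close>. Since
  the coefficient of \<open>t\<^bsup>i+n\<^esup>\<close> in \<open>(\<Sum>\<^sub>j x\<^sub>j t\<^sup>j) p\<close> is \<open>x\<^sub>i c\<close> up to terms from \<open>x\<^sub>j p\<close>, \<open>j > i\<close>, this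
  yields \<open>x\<^sub>i c \<in> I\<close> for \<open>i = N - 1, \<dots>, 0\<close> in turn, and \<open>c \<in> I\<close> by saturation.
\<close>

lemma generic_linear_cancel:
  fixes I :: "(nat, 'a::comm_ring_1) mpoly set"
  assumes I: "homogeneous_ideal N I" and sat: "saturation N I = I"
    and "coeffs_in (polys N) p" "coeffs_in I (generic_linear N * p)"
  shows "coeffs_in I p"
proof -
  have "\<forall>p. (\<forall>i\<ge>n. coeff p i = 0) \<longrightarrow> coeffs_in (polys N) p \<longrightarrow>
          coeffs_in I (generic_linear N * p) \<longrightarrow> coeffs_in I p" for n
  proof (induction n)
    case 0
    then show ?case by (simp add: coeffs_in_def ideal_0[OF I])
  next
    case (Suc n)
    show ?case
    proof (intro allI impI)
      fix p :: "(nat, 'a) mpoly poly"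
      assume p0: "\<forall>i\<ge>Suc n. coeff p i = 0" and pp: "coeffs_in (polys N) p"
        and fp: "coeffs_in I (generic_linear N * p)"
      define c where "c = coeff p n"
      have c: "c \<in> polys N" using pp by (simp add: c_def coeffs_in_def)
      \<comment> \<open>Stated for a general multiplier: it is used with the variables and, at the
        very end, with \<open>1\<close>.\<close>
      have step: "coeffs_in I (smult a p)" if a: "a \<in> polys N" and ac: "a * c \<in> I" for a
      proof -
        define q where "q = smult a p - monom (a * c) n"
        have m: "coeffs_in I (monom (a * c) n)"
          using ac by (simp add: coeffs_in_def ideal_0[OF I])
        have "coeffs_in (polys N) (monom (a * c) n)"
          using m ideal_polys[OF I] by (simp add: coeffs_in_def)
        moreover have "x - y \<in> polys N" if "x \<in> polys N" "y \<in> polys N" for x y :: "(nat, 'a) mpoly"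
          using polys_add[OF that(1) polys_uminus[OF that(2)]] by simp
        ultimately have q: "coeffs_in (polys N) q"
          using a pp by (simp add: q_def coeffs_in_def polys_mult)
        have "generic_linear N * q
                = smult a (generic_linear N * p) - generic_linear N * monom (a * c) n"
          by (simp add: q_def algebra_simps)
        moreover have "coeffs_in I (generic_linear N * monom (a * c) n)"
          by (intro coeffs_in_ideal_mult[OF I coeffs_in_forms_polys[OF generic_linear_forms]] m)
        ultimately have fq: "coeffs_in I (generic_linear N * q)"
          using fp a by (simp add: coeffs_in_def ideal_diff[OF I] ideal_mult[OF I])
        have "coeff q i = 0" if "i \<ge> n" for i
          using p0 that by (cases "i = n") (simp_all add: q_def c_def)
        with Suc q fq have "coeffs_in I q" by blast
        then have "coeffs_in I (q + monom (a * c) n)"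
          using m by (simp add: coeffs_in_def ideal_add[OF I])
        then show ?thesis by (simp add: q_def)
      qed
      have Var_c: "Var i * c \<in> I" if "i < N" for i
        using that
      proof (induction i rule: measure_induct_rule[of "\<lambda>i. N - i"])
        case (less i)
        have *: "Var i' * coeff p j \<in> I" if "i < i'" "i' < N" for i' j
        proof -
          have "coeffs_in I (smult (Var i') p)"
            using step[of "Var i'"] less that forms_polys[OF forms_Var[of i' N]] by auto
          then show ?thesis by (simp add: coeffs_in_def)
        qed
        let ?g = "\<lambda>i'. if i' \<le> i + n then Var i' * coeff p (i + n - i') else 0"
        have "coeff (generic_linear N * p) (i + n) = (\<Sum>i'<N. ?g i')"
          by (rule coeff_generic_linear_mult)
        also have "\<dots> = ?g i + (\<Sum>i'\<in>{..<N} - {i}. ?g i')"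
          using less.prems by (subst sum.remove[of _ i]) auto
        finally have "Var i * c = coeff (generic_linear N * p) (i + n) - (\<Sum>i'\<in>{..<N} - {i}. ?g i')"
          by (simp add: c_def)
        \<comment> \<open>For \<open>i' < i\<close> the coefficient has index above \<open>n\<close>
          and vanishes; for \<open>i' > i\<close> the term is covered by \<open>*\<close> or is
          \<open>0\<close>.\<close>
        moreover have "?g i' \<in> I" if "i' \<in> {..<N} - {i}" for i'
          using that p0 * ideal_0[OF I] by (cases "i' < i") auto
        ultimately show ?case
          using fp by (auto simp: coeffs_in_def intro!: ideal_diff[OF I] ideal_sum[OF I])
      qed
      have "g * c \<in> I" if g: "g \<in> forms N 1" for g
      proof -
        have "g * c = (\<Sum>j<N. const (lookup g (unit_exp j)) * Var j) * c"
          using linear_form_expand[OF g] by simp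
        also have "\<dots> = (\<Sum>j<N. const (lookup g (unit_exp j)) * (Var j * c))"
          by (simp add: sum_distrib_right mult.assoc)
        also have "\<dots> \<in> I"
          using Var_c by (intro ideal_sum[OF I] ideal_mult[OF I forms_polys[OF forms_const]]) auto
        finally show ?thesis .
      qed
      then have "c \<in> saturation N I"
        using c by (auto simp: saturation_def)
      then have "1 * c \<in> I" using sat by simp
      from step[OF polys_1 this] show "coeffs_in I p" by simp
    qed
  qed
  moreover have "\<forall>i\<ge>Suc (degree p). coeff p i = 0"
    by (simp add: coeff_eq_0)
  ultimately show ?thesis using assms(3,4) by blast
qed

lemma generic_linear_power_cancel:
  fixes I :: "(nat, 'a::comm_ring_1) mpoly set"
  assumes "homogeneous_ideal N I" "saturation N I = I"
    and "coeffs_in (polys N) p" "coeffs_in I (generic_linear N ^ n * p)"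
  shows "coeffs_in I p"
  using assms(4)
proof (induction n)
  case (Suc n)
  have "coeffs_in (polys N) (generic_linear N ^ n :: (nat, 'a) mpoly poly)"
    using coeffs_in_forms_polys[OF coeffs_in_forms_power[OF generic_linear_forms]] .
  then have "coeffs_in (polys N) (generic_linear N ^ n * p)"
    using assms(3) by (rule coeffs_in_polys_mult)
  with Suc show ?case
    using generic_linear_cancel[OF assms(1,2), of "generic_linear N ^ n * p"]
    by (simp add: mult.assoc)
qed simp

section \<open>Linear algebra\<close>

lemma inj_on_lookup: "inj_on (lookup :: ('a \<Rightarrow>\<^sub>0 'b::zero) \<Rightarrow> _) A"
  by (simp add: inj_on_def)

text \<open>Each exponent is at most the degree, so the exponent functions lie in a finite box. This
  makes \<open>forms N k\<close> finite-dimensional.\<close>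

lemma finite_monomials: "finite {m :: nat \<Rightarrow>\<^sub>0 nat. keys m \<subseteq> {..<N} \<and> mon_degree m = k}" (is "finite ?M")
proof -
  have "lookup ` ?M \<subseteq> {f. \<forall>v. (v \<in> {..<N} \<longrightarrow> f v \<in> {..k}) \<and> (v \<notin> {..<N} \<longrightarrow> f v = 0)}"
  proof clarsimp
    fix m :: "nat \<Rightarrow>\<^sub>0 nat" and v
    assume m: "keys m \<subseteq> {..<N}"
    have "lookup m v \<le> (\<Sum>v<N. lookup m v)" if "v < N"
      using that by (intro member_le_sum) auto
    then show "(v < N \<longrightarrow> lookup m v \<le> mon_degree m) \<and> (\<not> v < N \<longrightarrow> lookup m v = 0)"
      using m by (auto simp: mon_degree_altdef[of "{..<N}"] in_keys_iff)
  qed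
  then have "finite (lookup ` ?M)"
    by (rule finite_subset) (rule finite_set_of_finite_funs, simp_all)
  then show ?thesis
    by (rule finite_imageD) (rule inj_on_lookup)
qed

lemma forms_subset_span:
  "forms N k \<subseteq> mpoly_vs.span ((\<lambda>m. single m 1) ` {m. keys m \<subseteq> {..<N} \<and> mon_degree m = k})"
proof
  fix p :: "(nat, complex) mpoly" assume p: "p \<in> forms N k"
  have "p = (\<Sum>m\<in>keys p. const (lookup p m) * single m 1)"
    by (simp add: const_def mult_single flip: mpoly_expand)
  moreover have "\<dots> \<in> mpoly_vs.span ((\<lambda>m. single m 1) ` {m. keys m \<subseteq> {..<N} \<and> mon_degree m = k})"
    using formsD[OF p] by (intro mpoly_vs.span_sum mpoly_vs.span_scale mpoly_vs.span_base)
      (auto simp: in_keys_iff)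
  ultimately show "p \<in> mpoly_vs.span ((\<lambda>m. single m 1) ` {m. keys m \<subseteq> {..<N} \<and> mon_degree m = k})"
    by simp
qed

text \<open>A basis of \<open>V\<close> extends to one of \<open>forms N k\<close>; the coordinates
  along the \<open>r\<close> added vectors vanish together only on \<open>V\<close>. Linearity is
  recorded for indexed sums, the shape from which a linear system is read off later.\<close>

lemma codim_functionals:
  assumes V: "mpoly_vs.subspace V" "V \<subseteq> forms N k"
    and dim: "mpoly_vs.dim (forms N k) = mpoly_vs.dim V + r"
  shows "\<exists>lam :: nat \<Rightarrow> (nat, complex) mpoly \<Rightarrow> complex.
    (\<forall>b (A :: 'i set) c p. (\<forall>i\<in>A. p i \<in> forms N k) \<longrightarrow>
       lam b (\<Sum>i\<in>A. const (c i) * p i) = (\<Sum>i\<in>A. c i * lam b (p i))) \<and>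
    (\<forall>p\<in>forms N k. (\<forall>b<r. lam b p = 0) \<longrightarrow> p \<in> V)"
proof -
  obtain B0 where B0: "B0 \<subseteq> V" "mpoly_vs.independent B0" "V \<subseteq> mpoly_vs.span B0"
    "card B0 = mpoly_vs.dim V"
    using mpoly_vs.basis_exists[of V] by metis
  obtain B where B: "B0 \<subseteq> B" "B \<subseteq> forms N k" "mpoly_vs.independent B"
    "forms N k \<subseteq> mpoly_vs.span B"
    using mpoly_vs.maximal_independent_subset_extend[of B0 "forms N k"] B0 V(2) by blast
  have "finite B"
    using mpoly_vs.independent_span_bound[OF finite_imageI[OF finite_monomials] B(3)]
      subset_trans[OF B(2) forms_subset_span] by blast
  have "card B = mpoly_vs.dim (forms N k)"
    using B by (intro mpoly_vs.basis_card_eq_dim)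
  then have "card (B - B0) = r"
    using \<open>finite B\<close> B(1) dim B0(4) by (simp add: card_Diff_subset finite_subset)
  then obtain h where h: "bij_betw h {0..<r} (B - B0)"
    using ex_bij_betw_nat_finite[of "B - B0"] \<open>finite B\<close> by auto
  define lam where "lam = (\<lambda>b p. mpoly_vs.representation B p (h b))"
  have lin: "lam b (\<Sum>i\<in>A. const (c i) * p i) = (\<Sum>i\<in>A. c i * lam b (p i))"
    if "\<And>i. i \<in> A \<Longrightarrow> p i \<in> forms N k" for b c p and A :: "'i set"
    using that
  proof (induction A rule: infinite_finite_induct)
    case (insert i A)
    then have "p j \<in> mpoly_vs.span B" if "j \<in> insert i A" for j
      using B(4) that by blast
    then have "const (c i) * p i \<in> mpoly_vs.span B" "(\<Sum>i\<in>A. const (c i) * p i) \<in> mpoly_vs.span B"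
      "p i \<in> mpoly_vs.span B"
      by (auto intro: mpoly_vs.span_scale mpoly_vs.span_sum)
    with insert show ?case
      by (simp add: lam_def mpoly_vs.representation_add[OF B(3)] mpoly_vs.representation_scale[OF B(3)])
  qed (auto simp: lam_def mpoly_vs.representation_zero)
  have ker: "p \<in> V" if p: "p \<in> forms N k" and 0: "\<And>b. b < r \<Longrightarrow> lam b p = 0" for p
  proof -
    have *: "mpoly_vs.representation B p b = 0" if b: "b \<in> B - B0" for b
    proof -
      obtain i where i: "i < r" "b = h i" using bij_betw_imp_surj_on[OF h] b by force
      show ?thesis using 0[OF i(1)] unfolding lam_def i(2) .
    qed
    have "b \<in> B0" if b: "mpoly_vs.representation B p b \<noteq> 0" for b
      using *[of b] mpoly_vs.representation_ne_zero[OF b] b by blast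
    then have "(\<Sum>b | mpoly_vs.representation B p b \<noteq> 0. const (mpoly_vs.representation B p b) * b)
      \<in> V"
      using B0(1) by (intro mpoly_vs.subspace_sum[OF V(1)] mpoly_vs.subspace_scale[OF V(1)]) auto
    moreover have "p \<in> mpoly_vs.span B" using p B(4) by blast
    ultimately show ?thesis
      using mpoly_vs.sum_nonzero_representation_eq[OF B(3)] by simp
  qed
  show ?thesis using lin ker by (intro exI[of _ lam]) simp
qed

lemma det_zero_row:
  fixes A :: "'a::comm_ring_1 mat"
  assumes A: "A \<in> carrier_mat n n" and k: "k < n" "\<And>j. j < n \<Longrightarrow> A $$ (k, j) = 0"
  shows "det A = 0"
  unfolding det_def'[OF A]
proof (rule sum.neutral, clarify)
  fix p assume "p permutes {0..<n}"
  then have "p k < n" using k(1) by (metis atLeastLessThan_iff le0 permutes_in_image)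
  then have "(\<Prod>i = 0..<n. A $$ (i, p i)) = 0"
    using k by (intro prod_zero bexI[of _ k]) auto
  then show "signof p * (\<Prod>i = 0..<n. A $$ (i, p i)) = 0" by simp
qed

text \<open>Padding with zero rows gives a square matrix of determinant \<open>0\<close>; a kernel
  vector of it is a solution.\<close>

lemma homogeneous_system_nontrivial:
  fixes E :: "'i \<Rightarrow> 'j \<Rightarrow> 'a::field"
  assumes fin: "finite A" "finite B" and card: "card A < card B"
  shows "\<exists>x. (\<exists>j\<in>B. x j \<noteq> 0) \<and> (\<forall>i\<in>A. (\<Sum>j\<in>B. E i j * x j) = 0)"
proof -
  let ?n = "card B"
  obtain h where h: "bij_betw h {0..<card B} B"
    using ex_bij_betw_nat_finite[OF fin(2)] by blast
  obtain g where g: "bij_betw g {0..<card A} A"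
    using ex_bij_betw_nat_finite[OF fin(1)] by blast
  define M where "M = mat ?n ?n (\<lambda>(i, j). if i < card A then E (g i) (h j) else 0)"
  have M: "M \<in> carrier_mat ?n ?n" by (simp add: M_def)
  have "det M = 0"
    using card by (intro det_zero_row[OF M, of "card A"]) (auto simp: M_def)
  then obtain v where v: "v \<in> carrier_vec ?n" "v \<noteq> 0\<^sub>v ?n" "M *\<^sub>v v = 0\<^sub>v ?n"
    using det_0_iff_vec_prod_zero_field[OF M] by blast
  define x where "x = (\<lambda>j. v $ inv_into {0..<card B} h j)"
  have xh: "x (h j) = v $ j" if "j < ?n" for j
    using that h by (simp add: x_def bij_betw_def)
  obtain j0 where j0: "j0 < ?n" "v $ j0 \<noteq> 0"
    using v(1,2) by (metis carrier_vecD eq_vecI index_zero_vec(1) index_zero_vec(2))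
  have "(\<Sum>j\<in>B. E i j * x j) = 0" if "i \<in> A" for i
  proof -
    obtain k where k: "k < card A" "i = g k" using bij_betw_imp_surj_on[OF g] \<open>i \<in> A\<close> by force
    have "(\<Sum>j\<in>B. E i j * x j) = (\<Sum>j = 0..<?n. E i (h j) * x (h j))"
      by (rule sum.reindex_bij_betw[OF h, symmetric])
    also have "\<dots> = (\<Sum>j = 0..<?n. M $$ (k, j) * v $ j)"
      using k card by (intro sum.cong) (auto simp: M_def xh)
    also have "\<dots> = (M *\<^sub>v v) $ k"
      using k card v(1) M by (simp add: scalar_prod_def)
    also have "\<dots> = 0" using v(3) k card by simp
    finally show ?thesis .
  qed
  moreover have "h j0 \<in> B" using h j0 by (auto simp: bij_betw_def)
  moreover have "x (h j0) \<noteq> 0" using xh j0 by simp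
  ultimately show ?thesis by blast
qed

section \<open>The form\<close>

text \<open>With \<open>u = x\<^sub>d\<close> and \<open>v = x\<^bsub>d+1\<^esub>\<close>, this is the exponent of \<open>x\<^sub>k u\<^sup>k v\<^bsup>d-1-k\<^esup>\<close>.\<close>

definition wild_mon :: "nat \<Rightarrow> nat \<Rightarrow> (nat \<Rightarrow>\<^sub>0 nat)" where
  "wild_mon d k = unit_exp k + (single d k + single (Suc d) (d - 1 - k))"

definition wild_form :: "nat \<Rightarrow> (nat, complex) mpoly" where
  "wild_form d = (\<Sum>k<d. single (wild_mon d k) (1 / (fact k * fact (d - 1 - k))))"

text \<open>The coefficients of \<open>wild_form\<close> are chosen such that \<open>p \<circ> wild_form d = pairing d p\<close> for \<open>p \<in> T\<^sub>d\<close>.\<close>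

definition pairing :: "nat \<Rightarrow> (nat, complex) mpoly \<Rightarrow> complex" where
  "pairing d p = (\<Sum>k<d. lookup p (wild_mon d k))"

text \<open>Chosen such that \<open>pairing d (dual_mon d i \<cdot> x\<^sub>j)\<close> is \<open>1\<close> if \<open>i = j\<close> and \<open>0\<close> otherwise.\<close>

definition dual_mon :: "nat \<Rightarrow> nat \<Rightarrow> (nat \<Rightarrow>\<^sub>0 nat)" where
  "dual_mon d i =
     (if i < d then single d i + single (Suc d) (d - 1 - i)
      else if i = d then unit_exp (d - 1) + single d (d - 2)
      else unit_exp 0 + single (Suc d) (d - 2))"

lemma lookup_wild_mon:
  "k < d \<Longrightarrow> lookup (wild_mon d k) i =
     (if i = k then 1 else if i = d then k else if i = Suc d then d - 1 - k else 0)"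
  by (auto simp: wild_mon_def lookup_add lookup_single when_def)

lemma lookup_dual_mon:
  "d \<ge> 3 \<Longrightarrow> i < d + 2 \<Longrightarrow> lookup (dual_mon d i) n =
     (if i < d then (if n = d then i else if n = Suc d then d - 1 - i else 0)
      else if i = d then (if n = d - 1 then 1 else if n = d then d - 2 else 0)
      else (if n = 0 then 1 else if n = Suc d then d - 2 else 0))"
  by (simp add: dual_mon_def lookup_add lookup_single when_def)

lemma wild_mon_eq_iff: "k < d \<Longrightarrow> k' < d \<Longrightarrow> wild_mon d k = wild_mon d k' \<longleftrightarrow> k = k'"
  by (metis less_irrefl lookup_wild_mon)

lemma inj_wild_mon: "inj_on (wild_mon d) {..<d}"
  by (auto simp: inj_on_def wild_mon_eq_iff)

lemma wild_mon_forms: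
  assumes "k < d"
  shows "keys (wild_mon d k) \<subseteq> {..<d + 2}" "mon_degree (wild_mon d k) = d"
proof -
  show "keys (wild_mon d k) \<subseteq> {..<d + 2}"
    using assms by (auto simp: in_keys_iff lookup_wild_mon split: if_splits)
  show "mon_degree (wild_mon d k) = d"
    using assms by (simp add: wild_mon_def mon_degree_add)
qed

lemma dual_mon_forms:
  assumes "d \<ge> 3" "i < d + 2"
  shows "keys (dual_mon d i) \<subseteq> {..<d + 2}" "mon_degree (dual_mon d i) = d - 1"
proof -
  show "keys (dual_mon d i) \<subseteq> {..<d + 2}"
    using assms by (auto simp: in_keys_iff lookup_dual_mon split: if_splits)
  show "mon_degree (dual_mon d i) = d - 1"
    using assms by (auto simp: dual_mon_def mon_degree_add)
qed

text \<open>The \<open>k\<close> for which \<open>dual_mon d i\<close> times \<open>x_i\<close> is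
  the monomial \<open>wild_mon d k\<close>: the last one for \<open>u\<close>, the first one for
  \<open>v\<close>.\<close>

definition dual_index :: "nat \<Rightarrow> nat \<Rightarrow> nat" where
  "dual_index d i = (if i < d then i else if i = d then d - 1 else 0)"

text \<open>Comparing exponents, above all those of \<open>u\<close> and \<open>v\<close>, leaves
  one possibility. This makes the catalecticant of the form diagonal, the source of both conciseness
  and the lower bound on the border rank.\<close>

lemma dual_mon_eq_wild_mon_iff:
  assumes d: "d \<ge> 3" and i: "i < d + 2" and j: "j < d + 2" and k: "k < d"
  shows "dual_mon d i + unit_exp j = wild_mon d k \<longleftrightarrow> i = j \<and> k = dual_index d i"
proof
  assume *: "dual_mon d i + unit_exp j = wild_mon d k"
  have eq: "lookup (dual_mon d i) n + (if j = n then 1 else 0) = lookup (wild_mon d k) n" for n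
    using arg_cong[OF *, of "\<lambda>m. lookup m n"] by (simp add: lookup_add lookup_single when_def split: if_splits)
  have wild: "lookup (wild_mon d k) n = (if n = k then 1 else 0)" if "n < d" for n
    using that k by (simp add: lookup_wild_mon)
  have wild_u: "lookup (wild_mon d k) d = k" and wild_v: "lookup (wild_mon d k) (Suc d) = d - 1 - k"
    using k by (simp_all add: lookup_wild_mon)
  consider "i < d" | "i = d" | "i = Suc d" using i by linarith
  then show "i = j \<and> k = dual_index d i"
  proof cases
    case 1
    then have dual: "lookup (dual_mon d i) k = 0" "lookup (dual_mon d i) d = i"
      using k d by (simp_all add: lookup_dual_mon)
    have "j = k" using eq[of k] dual(1) wild[OF k] by (cases "j = k") auto
    moreover have "i = k" using eq[of d] dual(2) wild_u k \<open>j = k\<close> by auto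
    ultimately show ?thesis using 1 by (simp add: dual_index_def)
  next
    case 2
    then have dual: "lookup (dual_mon d i) (d - 2) = 0" "lookup (dual_mon d i) d = d - 2"
      "lookup (dual_mon d i) (Suc d) = 0"
      using d by (auto simp: lookup_dual_mon)
    show ?thesis
    proof (cases "j = d")
      case True
      then show ?thesis using eq[of d] dual wild_u 2 d by (simp add: dual_index_def)
    next
      case False
      \<comment> \<open>This candidate fails: \<open>j = d - 2\<close> follows, and then
        \<open>v\<close> has exponent \<open>0\<close> on the left and \<open>1\<close> on the
        right.\<close>
      then have k2: "k = d - 2" using eq[of d] dual wild_u by simp
      have "j = d - 2" using eq[of "d - 2"] dual(1) wild[of "d - 2"] k2 k by (cases "j = d - 2") auto
      moreover have "d - 1 - k = 1" using k2 d by simp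
      moreover have "d - 2 \<noteq> Suc d" by linarith
      ultimately show ?thesis using eq[of "Suc d"] dual(3) wild_v by simp
    qed
  next
    case 3
    then have dual: "lookup (dual_mon d i) 1 = 0" "lookup (dual_mon d i) d = 0"
      "lookup (dual_mon d i) (Suc d) = d - 2"
      using d by (auto simp: lookup_dual_mon)
    show ?thesis
    proof (cases "j = d")
      case True
      \<comment> \<open>This candidate would need a factor \<open>x_1\<close>, which the left side
        lacks.\<close>
      then have "k = 1" using eq[of d] dual wild_u by simp
      then show ?thesis using eq[of 1] dual wild[of 1] True d by simp
    next
      case False
      then have k0: "k = 0" using eq[of d] dual wild_u by simp
      have "d - 1 - k = (d - 2) + 1" using k0 d by simp
      then have "j = Suc d" using eq[of "Suc d"] dual(3) wild_v by (cases "j = Suc d") auto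
      then show ?thesis using 3 k0 by (simp add: dual_index_def)
    qed
  qed
next
  assume ij: "i = j \<and> k = dual_index d i"
  have d2: "Suc (d - 2) = d - 1" using d by simp
  consider "i < d" | "i = d" | "i = Suc d" using i by linarith
  then show "dual_mon d i + unit_exp j = wild_mon d k"
  proof cases
    case 1
    then show ?thesis using ij by (simp add: dual_mon_def wild_mon_def dual_index_def add_ac)
  next
    case 2
    have "unit_exp (d - 1) + single d (d - 2) + unit_exp d = unit_exp (d - 1) + single d (d - 1)"
      by (simp add: add.assoc d2 flip: single_add)
    then show ?thesis
      using 2 ij by (simp add: dual_mon_def wild_mon_def dual_index_def)
  next
    case 3
    have "unit_exp 0 + single (Suc d) (d - 2) + unit_exp (Suc d) = unit_exp 0 + single (Suc d) (d - 1)"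
      by (simp add: add.assoc d2 flip: single_add)
    then show ?thesis
      using 3 ij d by (simp add: dual_mon_def wild_mon_def dual_index_def)
  qed
qed

lemma dual_index_less: "d \<ge> 3 \<Longrightarrow> dual_index d i < d"
  by (simp add: dual_index_def)

lemma lookup_wild_form:
  assumes "k < d"
  shows "lookup (wild_form d) (wild_mon d k) = 1 / (fact k * fact (d - 1 - k))"
proof -
  have "lookup (wild_form d) (wild_mon d k)
      = (\<Sum>i<d. if i = k then 1 / (fact i * fact (d - 1 - i)) else 0)"
    unfolding wild_form_def lookup_sum
    by (intro sum.cong) (auto simp: lookup_single when_def wild_mon_eq_iff assms)
  then show ?thesis using assms by (simp add: sum.delta)
qed

lemma lookup_wild_form_0:
  "m \<notin> wild_mon d ` {..<d} \<Longrightarrow> lookup (wild_form d) m = 0"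
  by (auto simp: wild_form_def lookup_sum lookup_single when_def intro!: sum.neutral)

lemma wild_form_in_forms: "wild_form d \<in> forms (d + 2) d"
  unfolding wild_form_def by (intro forms_sum forms_single wild_mon_forms) auto

lemma wild_form_nonzero: "d > 0 \<Longrightarrow> wild_form d \<noteq> 0"
  using lookup_wild_form[of 0 d] by auto

text \<open>Only the exponent \<open>m + \<alpha>\<close> is carried to \<open>m\<close>: wherever
  the truncated difference loses information, one of the falling factorials is
  \<open>0\<close>.\<close>

lemma lookup_apply_diff:
  "lookup (apply_diff h F) m =
     (\<Sum>\<alpha>\<in>keys h. lookup h \<alpha> * lookup F (m + \<alpha>) *
        (\<Prod>i\<in>keys \<alpha>. of_nat ((lookup (m + \<alpha>) i choose lookup \<alpha> i) * fact (lookup \<alpha> i))))"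
proof -
  let ?c = "\<lambda>\<beta> \<alpha>. \<Prod>i\<in>keys \<alpha>. complex_of_nat ((lookup \<beta> i choose lookup \<alpha> i) * fact (lookup \<alpha> i))"
  have "(\<Sum>\<beta>\<in>keys F. lookup (single (\<beta> - \<alpha>) (lookup h \<alpha> * lookup F \<beta> * ?c \<beta> \<alpha>)) m)
      = lookup h \<alpha> * lookup F (m + \<alpha>) * ?c (m + \<alpha>) \<alpha>" for \<alpha>
  proof -
    have *: "?c \<beta> \<alpha> = 0" if ne: "\<beta> \<noteq> \<beta> - \<alpha> + \<alpha>" for \<beta>
    proof -
      from ne obtain i where "lookup \<beta> i \<noteq> lookup (\<beta> - \<alpha> + \<alpha>) i"
        using poly_mapping_eqI[of \<beta> "\<beta> - \<alpha> + \<alpha>"] by blast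
      then have "lookup \<beta> i < lookup \<alpha> i" by (auto simp: lookup_add lookup_minus)
      then show ?thesis by (intro prod_zero bexI[of _ i]) (auto simp: in_keys_iff)
    qed
    have "lookup (single (\<beta> - \<alpha>) (lookup h \<alpha> * lookup F \<beta> * ?c \<beta> \<alpha>)) m
        = (if \<beta> = m + \<alpha> then lookup h \<alpha> * lookup F \<beta> * ?c \<beta> \<alpha> else 0)" for \<beta>
      using *[of \<beta>] by (auto simp: lookup_single when_def)
    then show ?thesis by (simp add: sum.delta in_keys_iff)
  qed
  then show ?thesis by (simp add: apply_diff_def lookup_sum)
qed

lemma prod_fact_wild_mon:
  assumes "k < d"
  shows "(\<Prod>i\<in>keys (wild_mon d k). fact (lookup (wild_mon d k) i)) = fact k * fact (d - 1 - k)"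
proof -
  have "(\<Prod>i\<in>keys (wild_mon d k). fact (lookup (wild_mon d k) i))
      = (\<Prod>i\<in>{k, d, Suc d}. fact (lookup (wild_mon d k) i))"
    using assms by (intro prod.mono_neutral_left) (auto simp: in_keys_iff lookup_wild_mon split: if_splits)
  also have "\<dots> = fact k * fact (d - 1 - k)"
    using assms by (simp add: lookup_wild_mon)
  finally show ?thesis .
qed

text \<open>The factorials produced by differentiation cancel the denominators in
  \<open>wild_form d\<close>. For \<open>p\<close> of degree \<open>d\<close> the constant
  coefficient is all of the result.\<close>

lemma lookup_apply_diff_wild_form: "lookup (apply_diff p (wild_form d)) 0 = pairing d p"
proof -
  let ?g = "\<lambda>\<alpha>. lookup p \<alpha> * lookup (wild_form d) \<alpha> * (\<Prod>i\<in>keys \<alpha>. fact (lookup \<alpha> i))"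
  have "lookup (apply_diff p (wild_form d)) 0 = (\<Sum>\<alpha>\<in>keys p. ?g \<alpha>)"
    by (simp add: lookup_apply_diff)
  also have "\<dots> = (\<Sum>\<alpha>\<in>keys p \<union> wild_mon d ` {..<d}. ?g \<alpha>)"
    by (intro sum.mono_neutral_left) (auto simp: in_keys_iff)
  also have "\<dots> = (\<Sum>\<alpha>\<in>wild_mon d ` {..<d}. ?g \<alpha>)"
    by (intro sum.mono_neutral_right) (auto simp: lookup_wild_form_0)
  also have "\<dots> = (\<Sum>k<d. ?g (wild_mon d k))"
    by (simp add: sum.reindex[OF inj_wild_mon])
  also have "\<dots> = pairing d p"
    unfolding pairing_def
    by (intro sum.cong) (simp_all add: lookup_wild_form prod_fact_wild_mon)
  finally show ?thesis .
qed

lemma lookup_wild_form_dual_mon: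
  assumes "d \<ge> 3" "i < d + 2" "j < d + 2"
  shows "lookup (wild_form d) (dual_mon d i + unit_exp j) \<noteq> 0 \<longleftrightarrow> i = j"
proof (cases "i = j")
  case True
  then have "dual_mon d i + unit_exp j = wild_mon d (dual_index d i)"
    using assms dual_mon_eq_wild_mon_iff[of d i j] dual_index_less by blast
  then show ?thesis using assms(1) True by (simp add: lookup_wild_form dual_index_less)
next
  case False
  then have "dual_mon d i + unit_exp j \<notin> wild_mon d ` {..<d}"
    using assms dual_mon_eq_wild_mon_iff[of d i j] by auto
  then show ?thesis using False by (simp add: lookup_wild_form_0)
qed

text \<open>The coefficient of the derivative by \<open>h\<close> at \<open>dual_mon d i\<close> is
  a nonzero multiple of the \<open>i\<close>-th coefficient of \<open>h\<close>.\<close>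

lemma concise_wild_form:
  assumes d: "d \<ge> 3"
  shows "concise (d + 2) (wild_form d)"
  unfolding concise_def
proof
  fix h assume h: "h \<in> Ann (d + 2) (wild_form d) \<inter> forms (d + 2) 1"
  then have h1: "h \<in> forms (d + 2) 1" by simp
  let ?c = "\<lambda>i \<alpha>. \<Prod>n\<in>keys \<alpha>. complex_of_nat
              ((lookup (dual_mon d i + \<alpha>) n choose lookup \<alpha> n) * fact (lookup \<alpha> n))"
  let ?g = "\<lambda>i \<alpha>. lookup h \<alpha> * lookup (wild_form d) (dual_mon d i + \<alpha>) * ?c i \<alpha>"
  have "lookup h (unit_exp i) = 0" if i: "i < d + 2" for i
  proof -
    have "0 = lookup (apply_diff h (wild_form d)) (dual_mon d i)"
      using h by (simp add: Ann_def)
    also have "\<dots> = (\<Sum>\<alpha>\<in>keys h. ?g i \<alpha>)"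
      by (rule lookup_apply_diff)
    also have "\<dots> = (\<Sum>\<alpha>\<in>keys h \<union> {unit_exp i}. ?g i \<alpha>)"
      by (intro sum.mono_neutral_left) (auto simp: in_keys_iff)
    also have "\<dots> = (\<Sum>\<alpha>\<in>{unit_exp i}. ?g i \<alpha>)"
    proof (intro sum.mono_neutral_right ballI)
      fix \<alpha> assume \<alpha>: "\<alpha> \<in> keys h \<union> {unit_exp i} - {unit_exp i}"
      then have k: "lookup h \<alpha> \<noteq> 0" by (auto simp: in_keys_iff)
      obtain j where j: "\<alpha> = unit_exp j" using formsD(2)[OF h1 k] by (rule mon_degree_1E)
      have "j < d + 2" using formsD(1)[OF h1 k] j by simp
      then show "?g i \<alpha> = 0"
        using lookup_wild_form_dual_mon[OF d i, of j] \<alpha> j by auto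
    qed auto
    finally show ?thesis
      using lookup_wild_form_dual_mon[OF d i i]
        of_nat_neq_0[of "lookup (dual_mon d i) i", where ?'a = complex]
      by (simp add: lookup_add)
  qed
  then show "h = 0"
    using linear_form_expand[OF h1] by (simp add: const_def)
qed

section \<open>No small apolar scheme\<close>

lemma pairing_sum: "pairing d (\<Sum>i\<in>A. p i) = (\<Sum>i\<in>A. pairing d (p i))"
  unfolding pairing_def lookup_sum by (rule sum.swap)

lemma pairing_0 [simp]: "pairing d 0 = 0"
  by (simp add: pairing_def)

lemma pairing_add: "pairing d (p + q) = pairing d p + pairing d q"
  by (simp add: pairing_def lookup_add sum.distrib)

lemma pairing_const_mult: "pairing d (const c * p) = c * pairing d p"
  by (simp add: pairing_def sum_distrib_left)

text \<open>For \<open>i < d\<close> the variable \<open>x_i\<close> divides only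
  \<open>wild_mon d i\<close>, with quotient \<open>dual_mon d i\<close>.\<close>

lemma pairing_Var_mult:
  assumes "i < d"
  shows "pairing d (Var i * p) = lookup p (dual_mon d i)"
proof -
  have "lookup (Var i * p) (wild_mon d k) = (if k = i then lookup p (dual_mon d i) else 0)"
    if k: "k < d" for k
  proof (cases "k = i")
    case True
    then show ?thesis
      using k by (simp add: Var_def wild_mon_def dual_mon_def)
  next
    case False
    have "wild_mon d k \<noteq> unit_exp i + b" for b
    proof
      assume "wild_mon d k = unit_exp i + b"
      then have "lookup (wild_mon d k) i = lookup (unit_exp i + b) i" by simp
      then show False using False k assms by (simp add: lookup_wild_mon lookup_add)
    qed
    then show ?thesis using False by (simp add: Var_def lookup_mult_single_0)
  qed
  then show ?thesis using assms by (simp add: pairing_def sum.delta)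
qed

text \<open>Applied to \<open>wild_form d\<close> it gives \<open>(v - t u)^(d-1) / (d-1)!\<close>.
  On forms in \<open>u\<close> and \<open>v\<close> the generic linear form acts as
  \<open>t^d d/du + t^(d+1) d/dv\<close>, which kills \<open>v - t u\<close>.\<close>

definition annihilator_poly :: "nat \<Rightarrow> (nat, complex) mpoly poly" where
  "annihilator_poly d = (\<Sum>i<d. monom (const ((-1) ^ i) * Var i) i)"

lemma annihilator_poly_forms: "coeffs_in (forms (d + 2) 1) (annihilator_poly d)"
proof -
  have "coeff (annihilator_poly d) n = (if n < d then const ((-1) ^ n) * Var n else 0)" for n
    by (simp add: annihilator_poly_def coeff_sum sum.delta)
  moreover have "const ((-1 :: complex) ^ n) * Var n \<in> forms (d + 2) 1" if "n < d" for n
    using that by (intro forms_const_mult forms_Var) simp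
  ultimately show ?thesis by (simp add: coeffs_in_def)
qed

lemma pairing_annihilator_poly_mult:
  "pairing d (coeff (annihilator_poly d * P) s)
     = (\<Sum>i<d. (-1) ^ i * (if i \<le> s then lookup (coeff P (s - i)) (dual_mon d i) else 0))"
proof -
  have "coeff (annihilator_poly d * P) s
      = (\<Sum>i<d. const ((-1) ^ i) * (if i \<le> s then Var i * coeff P (s - i) else 0))"
    unfolding annihilator_poly_def sum_distrib_right coeff_sum
    by (intro sum.cong) (auto simp: coeff_monom_mult mult.assoc)
  then show ?thesis
    by (simp add: pairing_sum pairing_const_mult pairing_Var_mult if_distrib[of "pairing d"] cong: if_cong)
qed

text \<open>Removing \<open>v\<close> from \<open>dual_mon d i\<close> and removing \<open>u\<close>
  from \<open>dual_mon d (i + 1)\<close> leave the same monomial; the telescoping sum below rests on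
  this.\<close>

lemma dual_mon_split:
  assumes "d \<ge> 3"
  shows "0 < i \<Longrightarrow> i < d \<Longrightarrow>
           dual_mon d i = unit_exp d + (single d (i - 1) + single (Suc d) (d - 1 - i))"
    and "Suc i < d \<Longrightarrow>
           dual_mon d i = unit_exp (Suc d) + (single d i + single (Suc d) (d - 1 - Suc i))"
proof -
  show "dual_mon d i = unit_exp d + (single d (i - 1) + single (Suc d) (d - 1 - i))"
    if "0 < i" "i < d"
  proof -
    have "unit_exp d + single d (i - 1) = single d i" using that by (simp flip: single_add)
    then show ?thesis using that by (simp add: dual_mon_def add.assoc[symmetric])
  qed
  show "dual_mon d i = unit_exp (Suc d) + (single d i + single (Suc d) (d - 1 - Suc i))"
    if "Suc i < d"
  proof -
    have "Suc (d - 1 - Suc i) = d - 1 - i" using that by simp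
    then have "unit_exp (Suc d) + single (Suc d) (d - 1 - Suc i) = single (Suc d) (d - 1 - i)"
      by (simp flip: single_add)
    then show ?thesis using that by (simp add: dual_mon_def add.left_commute)
  qed
qed

lemma alternating_telescope:
  fixes U :: "nat \<Rightarrow> 'a::comm_ring_1"
  shows "(\<Sum>i<n. (-1) ^ i * (U i + U (Suc i))) = U 0 - (-1) ^ n * U n"
  by (induction n) (simp_all add: algebra_simps)

text \<open>
  The coefficients of \<open>annihilator_poly d\<close> solve \<open>\<ell> h \<circ> F = 0\<close> for the generic linear form
  \<open>\<ell>\<close>. Such a nonzero \<open>h\<close> exists because the \<open>d \<times> d\<close> block of the Hessian of \<open>F\<close> belonging to
  \<open>x\<^sub>0, \<dots>, x\<^bsub>d-1\<^esub>\<close> vanishes, so that its determinant is \<open>0\<close>.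
\<close>

lemma pairing_annihilator_generic:
  assumes d: "d \<ge> 3"
  shows "pairing d (coeff (annihilator_poly d * (generic_linear (d + 2) * q)) s) = 0"
proof -
  \<comment> \<open>What the summand \<open>u t^d\<close> contributes at
    \<open>dual_mon d i\<close>, and equally what \<open>v t^(d+1)\<close> contributes at
    \<open>dual_mon d (i - 1)\<close>. The default \<open>0\<close> covers both ends
    \<open>i = 0\<close> and \<open>i = d\<close>, so the telescoped sum vanishes.\<close>
  define U where "U i = (if 0 < i \<and> i < d \<and> i + d \<le> s
    then lookup (coeff q (s - (i + d))) (single d (i - 1) + single (Suc d) (d - 1 - i)) else 0)" for i
  have "lookup (coeff (generic_linear (d + 2) * q) (s - i)) (dual_mon d i) = U i + U (Suc i)"
    if i: "i < d" "i \<le> s" for i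
  proof -
    let ?t = "\<lambda>j. if j \<le> s - i then lookup (Var j * coeff q (s - i - j)) (dual_mon d i) else 0"
    have "lookup (coeff (generic_linear (d + 2) * q) (s - i)) (dual_mon d i) = (\<Sum>j<d + 2. ?t j)"
      unfolding coeff_generic_linear_mult lookup_sum by (intro sum.cong) auto
    \<comment> \<open>For \<open>i < d\<close> no variable other than \<open>u\<close> and
      \<open>v\<close> divides \<open>dual_mon d i\<close>.\<close>
    also have "\<dots> = (\<Sum>j\<in>{d, Suc d}. ?t j)"
    proof (intro sum.mono_neutral_right ballI)
      fix j assume "j \<in> {..<d + 2} - {d, Suc d}"
      then show "?t j = 0"
        using i d by (simp add: lookup_Var_mult_0 lookup_dual_mon)
    qed auto
    also have "?t d = U i"
    proof (cases "0 < i")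
      case True
      then show ?thesis
        using i dual_mon_split(1)[OF d True i(1)] by (auto simp: U_def Var_def)
    next
      case False
      then show ?thesis using d by (simp add: U_def lookup_Var_mult_0 lookup_dual_mon)
    qed
    moreover have "?t (Suc d) = U (Suc i)"
    proof (cases "Suc i < d")
      case True
      then show ?thesis
        using i dual_mon_split(2)[OF d True] by (auto simp: U_def Var_def)
    next
      case False
      then show ?thesis using d i by (simp add: U_def lookup_Var_mult_0 lookup_dual_mon)
    qed
    ultimately show ?thesis by simp
  qed
  moreover have "U i + U (Suc i) = 0" if "\<not> i \<le> s" for i
    using that by (simp add: U_def)
  ultimately have "pairing d (coeff (annihilator_poly d * (generic_linear (d + 2) * q)) s)
      = (\<Sum>i<d. (-1) ^ i * (U i + U (Suc i)))"
    unfolding pairing_annihilator_poly_mult by (intro sum.cong) auto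
  moreover have "U 0 = 0" "U d = 0" by (simp_all add: U_def)
  ultimately show ?thesis by (simp add: alternating_telescope)
qed

text \<open>An effective form of conciseness: it forces linear forms in an apolar ideal to be
  \<open>0\<close>, since their multiples of degree \<open>d\<close> pair to
  \<open>0\<close>.\<close>

lemma pairing_dual_mon_linear:
  assumes d: "d \<ge> 3" and i: "i < d + 2" and q: "q \<in> forms (d + 2) 1"
  shows "pairing d (single (dual_mon d i) 1 * q) = lookup q (unit_exp i)"
proof -
  have "single (dual_mon d i) 1 * q
      = (\<Sum>j<d + 2. single (dual_mon d i + unit_exp j) (lookup q (unit_exp j)))"
    by (subst linear_form_expand[OF q])
      (simp only: sum_distrib_left const_def Var_def mult_single add_0 mult_1 mult_1_right)
  moreover have "pairing d (single (dual_mon d i + unit_exp j) c) = (if j = i then c else 0)"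
    if j: "j < d + 2" for j c
  proof -
    have "pairing d (single (dual_mon d i + unit_exp j) c)
        = (\<Sum>k<d. if k = dual_index d i then (if i = j then c else 0) else 0)"
      unfolding pairing_def lookup_single when_def
      using dual_mon_eq_wild_mon_iff[OF d i j] by (intro sum.cong) auto
    then show ?thesis using dual_index_less[OF d, of i] by (simp add: sum.delta)
  qed
  ultimately have "pairing d (single (dual_mon d i) 1 * q)
      = (\<Sum>j<d + 2. if j = i then lookup q (unit_exp j) else 0)"
    by (simp only: pairing_sum) (intro sum.cong, auto)
  then show ?thesis using i by (simp only: sum.delta finite_lessThan lessThan_iff if_True)
qed

lemma coeff_sum_monom_const_mult:
  fixes V :: "(nat, 'a::comm_semiring_1) mpoly poly"
  shows "coeff ((\<Sum>m\<le>M. monom (const (x m)) m) * V) s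
       = (\<Sum>m\<le>M. const (x m) * (if m \<le> s then coeff V (s - m) else 0))"
  unfolding sum_distrib_right coeff_sum by (intro sum.cong) (auto simp: coeff_monom_mult)

text \<open>
  A length count over \<open>\<complex>[t]\<close>: the elements \<open>V\<^sub>0, \<dots>, V\<^sub>N\<close> of \<open>T\<^sub>k[t]\<close> are linearly dependent over
  \<open>\<complex>[t]\<close> modulo \<open>I\<^sub>k[t]\<close>, as \<open>T\<^sub>k / I\<^sub>k\<close> has dimension \<open>r \<le> N\<close>. The coefficients of the relation
  solve a linear system over \<open>\<complex>\<close>; it has more unknowns than equations because
  \<open>(N + 1)(N E + 1) > N (N E + E + 1)\<close>.
\<close>

lemma polynomial_relation:
  fixes V :: "nat \<Rightarrow> (nat, complex) mpoly poly"
  assumes I: "homogeneous_ideal N I"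
    and dim: "mpoly_vs.dim (forms N k) = mpoly_vs.dim (I \<inter> forms N k) + r" and r: "r \<le> n"
    and V: "\<And>j. j \<le> n \<Longrightarrow> coeffs_in (forms N k) (V j)"
  obtains x M j m where
    "coeffs_in I (\<Sum>j\<le>n. (\<Sum>m\<le>M. monom (const (x j m)) m) * V j)"
    "j \<le> n" "m \<le> M" "x j m \<noteq> 0"
proof -
  have sub: "mpoly_vs.subspace (I \<inter> forms N k)"
    unfolding mpoly_vs.subspace_def
    by (auto intro: ideal_0[OF I] ideal_add[OF I] ideal_mult[OF I] forms_add forms_const_mult
        forms_polys[OF forms_const])
  obtain lam :: "nat \<Rightarrow> (nat, complex) mpoly \<Rightarrow> complex" where
    lin: "\<forall>b (A :: (nat \<times> nat) set) c p. (\<forall>i\<in>A. p i \<in> forms N k) \<longrightarrow>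
       lam b (\<Sum>i\<in>A. const (c i) * p i) = (\<Sum>i\<in>A. c i * lam b (p i))"
    and ker: "\<forall>p\<in>forms N k. (\<forall>b<r. lam b p = 0) \<longrightarrow> p \<in> I \<inter> forms N k"
    using codim_functionals[OF sub Int_lower2 dim] by (elim exE conjE) (rule that)
  define E where "E = Max ((\<lambda>j. degree (V j)) ` {..n})"
  have E: "degree (V j) \<le> E" if "j \<le> n" for j
    unfolding E_def using that by (intro Max_ge) auto
  define M where "M = n * E"
  \<comment> \<open>The coefficient of \<open>t^s\<close> in \<open>t^m V_j\<close>, so that the
    unknowns enter linearly.\<close>
  define W where "W = (\<lambda>jm s. if snd jm \<le> s then coeff (V (fst jm)) (s - snd jm) else 0)"
  have "r * (M + E + 1) \<le> n * (M + E + 1)" by (intro mult_le_mono1 r)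
  also have "\<dots> < (n + 1) * (M + 1)" by (simp add: M_def algebra_simps)
  finally have card: "card ({..<r} \<times> {..M + E}) < card ({..n} \<times> {..M})" by simp
  have fin: "finite ({..<r} \<times> {..M + E})" "finite ({..n} \<times> {..M})" by simp_all
  obtain x jm where jm: "jm \<in> {..n} \<times> {..M}" "x jm \<noteq> 0"
    and x: "\<forall>bs\<in>{..<r} \<times> {..M + E}.
      (\<Sum>jm\<in>{..n} \<times> {..M}. lam (fst bs) (W jm (snd bs)) * x jm) = 0"
    using homogeneous_system_nontrivial[OF fin card, of "\<lambda>bs jm. lam (fst bs) (W jm (snd bs))"]
    by (elim exE conjE bexE) (rule that)
  define Z where "Z = (\<Sum>j\<le>n. (\<Sum>m\<le>M. monom (const (x (j, m))) m) * V j)"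
  have coeff_Z: "coeff Z s = (\<Sum>jm\<in>{..n} \<times> {..M}. const (x jm) * W jm s)" for s
    unfolding Z_def coeff_sum coeff_sum_monom_const_mult sum.cartesian_product
    by (intro sum.cong) (auto simp: W_def)
  have W: "W jm s \<in> forms N k" if "jm \<in> {..n} \<times> {..M}" for jm s
    using V that by (auto simp: W_def coeffs_in_def)
  have "coeff Z s \<in> I" for s
  proof (cases "s \<le> M + E")
    case True
    have "lam b (coeff Z s) = 0" if "b < r" for b
    proof -
      have "lam b (coeff Z s) = (\<Sum>jm\<in>{..n} \<times> {..M}. x jm * lam b (W jm s))"
        unfolding coeff_Z using lin W by simp
      also have "\<dots> = 0"
        using bspec[OF x, of "(b, s)"] that True by (simp add: mult.commute)
      finally show ?thesis .
    qed
    moreover have "coeff Z s \<in> forms N k"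
      unfolding coeff_Z by (intro forms_sum forms_const_mult W)
    ultimately show ?thesis using ker by blast
  next
    \<comment> \<open>Beyond degree \<open>M + E\<close> every coefficient vanishes, so finitely
      many equations suffice.\<close>
    case False
    have "W jm s = 0" if "jm \<in> {..n} \<times> {..M}" for jm
    proof -
      have "degree (V (fst jm)) < s - snd jm"
        using E[of "fst jm"] that False by auto
      then show ?thesis by (simp add: W_def coeff_eq_0)
    qed
    then have "coeff Z s = 0" unfolding coeff_Z by simp
    then show ?thesis by (simp add: ideal_0[OF I])
  qed
  then have "coeffs_in I Z" by (simp add: coeffs_in_def)
  then show thesis
    using that[where x = "\<lambda>j m. x (j, m)" and M = M and j = "fst jm" and m = "snd jm"] jm by (auto simp: Z_def)
qed

text \<open>The length controls dimensions only in large degree \<open>k\<close>. There the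
  \<open>d + 3\<close> elements \<open>\<ell>^(k-1) x_j\<close> and
  \<open>\<ell>^(k-d+1) v^(d-1)\<close> are dependent over \<open>\<complex>[t]\<close> modulo
  \<open>I\<close> if \<open>r\<close> is at most \<open>d + 2\<close>. Cancelling powers of
  \<open>\<ell>\<close> carries the relation down to degree \<open>d - 1\<close> and, once its last
  coefficient is known to vanish, to degree \<open>1\<close>, where conciseness applies.\<close>

lemma small_scheme_not_apolar:
  assumes d: "d \<ge> 3" and Z: "zero_dim_scheme (d + 2) r I"
    and F: "wild_form d \<in> linear_span (d + 2) d I"
  shows "r > d + 2"
proof (rule ccontr)
  let ?N = "d + 2" and ?f = "generic_linear (d + 2) :: (nat, complex) mpoly poly"
  let ?h = "annihilator_poly d"
  assume "\<not> r > ?N"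
  then have r: "r \<le> ?N" by simp
  have I: "homogeneous_ideal ?N I" and sat: "saturation ?N I = I"
    using Z by (auto simp: zero_dim_scheme_def)
  obtain k0 where k0: "\<And>k. k \<ge> k0 \<Longrightarrow>
      mpoly_vs.dim (forms ?N k) = mpoly_vs.dim (I \<inter> forms ?N k) + r"
    using Z by (auto simp: zero_dim_scheme_def)
  have pairing_I: "pairing d p = 0" if "p \<in> I" "p \<in> forms ?N d" for p
    using F that lookup_apply_diff_wild_form[of p d] by (auto simp: linear_span_def)
  have I1: "lookup q (unit_exp i) = 0" if q: "q \<in> I" "q \<in> forms ?N 1" and i: "i < ?N" for q i
  proof -
    have m: "single (dual_mon d i) (1::complex) \<in> forms ?N (d - 1)"
      by (intro forms_single dual_mon_forms d i)
    have "single (dual_mon d i) 1 * q \<in> forms ?N (d - 1 + 1)"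
      by (rule forms_mult[OF m q(2)])
    then have "pairing d (single (dual_mon d i) 1 * q) = 0"
      using d by (intro pairing_I ideal_mult[OF I] forms_polys[OF m] q(1)) simp
    then show ?thesis using pairing_dual_mon_linear[OF d i q(2)] by simp
  qed
  define k where "k = max k0 d"
  \<comment> \<open>The monomial \<open>v^(d-1)\<close>; its product with
    \<open>annihilator_poly d\<close> pairs to \<open>1\<close>, so it detects the last coefficient
    \<open>C ?N\<close>.\<close>
  define g :: "(nat, complex) mpoly" where "g = single (dual_mon d 0) 1"
  define V where "V j = (if j < ?N then ?f ^ (k - 1) * [:Var j:] else ?f ^ (k - (d - 1)) * [:g:])" for j
  have g: "coeffs_in (forms ?N (d - 1)) [:g:]"
    using dual_mon_forms[OF d, of 0]
    by (auto simp: coeffs_in_def coeff_pCons g_def intro!: forms_single split: nat.split)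
  have Var: "coeffs_in (forms ?N 1) [:Var j:]" if "j < ?N" for j
    using forms_Var[OF that] by (auto simp: coeffs_in_def coeff_pCons split: nat.split)
  have f: "coeffs_in (forms ?N n) (?f ^ n)" for n
    using coeffs_in_forms_power[OF generic_linear_forms, of ?N n] by simp
  have "coeffs_in (forms ?N k) (V j)" if "j \<le> ?N" for j
  proof (cases "j < ?N")
    case True
    have "k - 1 + 1 = k" using d by (simp add: k_def)
    then show ?thesis using coeffs_in_forms_mult[OF f[of "k - 1"] Var[OF True]] True
      by (simp add: V_def)
  next
    case False
    have "k - (d - 1) + (d - 1) = k" by (simp add: k_def)
    then show ?thesis using coeffs_in_forms_mult[OF f[of "k - (d - 1)"] g] False
      by (simp add: V_def)
  qed
  moreover have "k0 \<le> k" by (simp add: k_def)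
  ultimately obtain x M j0 m0 where
    rel: "coeffs_in I (\<Sum>j\<le>?N. (\<Sum>m\<le>M. monom (const (x j m)) m) * V j)" and
    x: "j0 \<le> ?N" "m0 \<le> M" "x j0 m0 \<noteq> (0::complex)"
    using polynomial_relation[OF I k0 r, of k V] by blast
  define C :: "nat \<Rightarrow> (nat, complex) mpoly poly"
    where "C = (\<lambda>j. \<Sum>m\<le>M. monom (const (x j m)) m)"
  have C: "coeff (C j) s = (if s \<le> M then const (x j s) else 0)" for j s
    by (simp add: C_def coeff_sum sum.delta)
  have C_forms: "coeffs_in (forms ?N 0) (C j)" for j
    by (simp add: coeffs_in_def C forms_const)
  define Q where "Q = (\<Sum>j<?N. C j * [:Var j:])"
  define W where "W = ?f ^ (d - 2) * Q + C ?N * [:g:]"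
  have sum_in: "coeffs_in (forms ?N n) (\<Sum>a\<in>A. P a)"
    if "\<And>a. a \<in> A \<Longrightarrow> coeffs_in (forms ?N n) (P a)" for n P and A :: "nat set"
    using that by (auto simp: coeffs_in_def coeff_sum intro!: forms_sum)
  have Q: "coeffs_in (forms ?N 1) Q"
    unfolding Q_def using coeffs_in_forms_mult[OF C_forms Var] by (intro sum_in) simp
  have fQ: "coeffs_in (forms ?N (d - 1)) (?f ^ (d - 2) * Q)"
  proof -
    have "d - 2 + 1 = d - 1" using d by simp
    then show ?thesis using coeffs_in_forms_mult[OF f[of "d - 2"] Q] by simp
  qed
  have Cg: "coeffs_in (forms ?N (d - 1)) (C ?N * [:g:])"
    using coeffs_in_forms_mult[OF C_forms g] by simp
  have W: "coeffs_in (forms ?N (d - 1)) W"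
    using fQ Cg by (auto simp: W_def coeffs_in_def intro: forms_add)
  have "(\<Sum>j\<le>?N. C j * V j) = ?f ^ (k - (d - 1)) * W"
  proof -
    have CV: "(\<Sum>j<?N. C j * (P * [:Var j:])) = P * Q" for P
      by (simp only: Q_def sum_distrib_left mult.left_commute)
    have VN: "V ?N = ?f ^ (k - (d - 1)) * [:g:]" by (simp add: V_def)
    have "(\<Sum>j\<le>?N. C j * V j) = (\<Sum>j<?N. C j * (?f ^ (k - 1) * [:Var j:])) + C ?N * V ?N"
      unfolding lessThan_Suc_atMost[symmetric] sum.lessThan_Suc
      by (intro arg_cong2[of _ _ _ _ "(+)"] sum.cong) (auto simp: V_def)
    also have "k - 1 = k - (d - 1) + (d - 2)" using d by (simp add: k_def)
    finally have "(\<Sum>j\<le>?N. C j * V j)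
        = ?f ^ (k - (d - 1) + (d - 2)) * Q + C ?N * (?f ^ (k - (d - 1)) * [:g:])"
      unfolding CV VN .
    then show ?thesis by (simp only: W_def power_add distrib_left mult_ac)
  qed
  then have IW: "coeffs_in I W"
    using generic_linear_power_cancel[OF I sat coeffs_in_forms_polys[OF W], of "k - (d - 1)"]
      rel by (simp add: C_def)
  have CN0: "C ?N = 0"
  proof (rule poly_eqI)
    fix s
    have "coeffs_in I (?h * W)"
      by (rule coeffs_in_ideal_mult[OF I coeffs_in_forms_polys[OF annihilator_poly_forms] IW])
    moreover have "coeffs_in (forms ?N d) (?h * W)"
      using coeffs_in_forms_mult[OF annihilator_poly_forms W] d by simp
    ultimately have "pairing d (coeff (?h * W) s) = 0"
      by (simp add: coeffs_in_def pairing_I)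
    \<comment> \<open>Here \<open>d \<ge> 3\<close> supplies a factor \<open>\<ell>\<close> next to
      \<open>h\<close>, so this part of the product pairs to \<open>0\<close>.\<close>
    moreover have "?f ^ (d - 2) = ?f * ?f ^ (d - 3)"
      using d by (simp add: Suc_diff_Suc numeral_eq_Suc flip: power_Suc)
    then have "?h * W = ?h * (?f * (?f ^ (d - 3) * Q)) + ?h * (C ?N * [:g:])"
      by (simp add: W_def algebra_simps)
    ultimately have "pairing d (coeff (?h * (C ?N * [:g:])) s) = 0"
      using pairing_annihilator_generic[OF d] by (simp add: pairing_add)
    moreover have "pairing d (coeff (?h * (C ?N * [:g:])) s) = lookup (coeff (C ?N) s) 0"
    proof -
      have eq: "dual_mon d 0 = dual_mon d i \<longleftrightarrow> i = 0" if "i < d" for i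
        using that d lookup_dual_mon[OF d, of i d] lookup_dual_mon[OF d, of 0 d] by auto
      have "(-1) ^ i * (if i \<le> s then lookup (coeff (C ?N * [:g:]) (s - i)) (dual_mon d i) else 0)
          = (if i = 0 then lookup (coeff (C ?N) s) 0 else 0)" if "i < d" for i
        using eq[OF that]
        by (cases "i = 0")
          (simp_all add: C g_def const_def mult_single lookup_single when_def mult.commute[of _ "[:_:]"])
      then show ?thesis
        unfolding pairing_annihilator_poly_mult using d by (simp add: sum.delta)
    qed
    ultimately show "coeff (C ?N) s = coeff 0 s"
      by (simp add: C const_def split: if_splits)
  qed
  \<comment> \<open>With \<open>C ?N = 0\<close> only \<open>\<ell>^(d-2) Q\<close> is left;
    cancelling gives linear forms in \<open>I\<close>, all zero, whose coefficients are the numbers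
    \<open>x j m\<close>.\<close>
  have "coeffs_in I Q"
    using generic_linear_power_cancel[OF I sat coeffs_in_forms_polys[OF Q], of "d - 2"] IW CN0
    by (simp add: W_def)
  then have Q0: "lookup (coeff Q s) (unit_exp i) = 0" if "i < ?N" for s i
    using Q that by (intro I1) (auto simp: coeffs_in_def)
  have "lookup (coeff Q m0) (unit_exp i) = x i m0" if i: "i < ?N" for i
  proof -
    have "unit_exp i = unit_exp j \<longleftrightarrow> j = i" for j :: nat
      by (metis lookup_single_eq lookup_single_not_eq nat.distinct(1))
    then have "lookup (coeff (C j * [:Var j:]) m0) (unit_exp i) = (if j = i then x j m0 else 0)" for j
      using x(2) by (simp add: C lookup_Var mult.commute[of _ "[:_:]"] mult.commute[of "Var _"])
    then show ?thesis
      using i by (simp add: Q_def coeff_sum lookup_sum sum.delta del: sum.lessThan_Suc)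
  qed
  moreover have "x ?N m0 = 0"
  proof -
    have "const (x ?N m0) = (0 :: (nat, complex) mpoly)" using C[of ?N m0] CN0 x(2) by simp
    then have "lookup (const (x ?N m0) :: (nat, complex) mpoly) 0 = 0" by simp
    then show ?thesis by (simp add: const_def)
  qed
  ultimately show False using x Q0 by (cases "j0 < ?N") auto
qed

section \<open>Border rank at least \<open>d + 2\<close>\<close>

definition mon_value :: "('v \<Rightarrow> 'a::comm_semiring_1) \<Rightarrow> ('v \<Rightarrow>\<^sub>0 nat) \<Rightarrow> 'a" where
  "mon_value a m = (\<Prod>v\<in>keys m. a v ^ lookup m v)"

definition mon_fact :: "('v \<Rightarrow>\<^sub>0 nat) \<Rightarrow> 'a::{comm_semiring_1,semiring_char_0}" where
  "mon_fact m = (\<Prod>v\<in>keys m. fact (lookup m v))"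

lemma mon_value_add: "mon_value a (m + n) = mon_value a m * mon_value a n"
proof -
  let ?A = "keys m \<union> keys n"
  have "mon_value a k = (\<Prod>v\<in>?A. a v ^ lookup k v)" if "keys k \<subseteq> ?A" for k
    unfolding mon_value_def using that by (intro prod.mono_neutral_left) (auto simp: in_keys_iff)
  from this[of m] this[of n] this[OF Poly_Mapping.keys_add] show ?thesis
    by (simp add: lookup_add power_add prod.distrib)
qed

lemma mon_value_0 [simp]: "mon_value a 0 = 1"
  by (simp add: mon_value_def)

lemma mon_value_unit_exp [simp]: "mon_value a (unit_exp v) = a v"
  by (simp add: mon_value_def)

lemma mon_value_sum: "mon_value a (\<Sum>i\<in>A. m i) = (\<Prod>i\<in>A. mon_value a (m i))"
  by (induction A rule: infinite_finite_induct) (auto simp: mon_value_add)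

lemma mon_fact_unit_exp_add:
  "(mon_fact (unit_exp j + b) :: 'a::{comm_semiring_1,semiring_char_0})
     = of_nat (Suc (lookup b j)) * mon_fact b"
proof -
  let ?A = "insert j (keys b)"
  have *: "(mon_fact k :: 'a) = fact (lookup k j) * (\<Prod>v\<in>?A - {j}. fact (lookup k v))"
    if "keys k \<subseteq> ?A" for k
  proof -
    have "(mon_fact k :: 'a) = (\<Prod>v\<in>?A. fact (lookup k v))"
      unfolding mon_fact_def using that by (intro prod.mono_neutral_left) (auto simp: in_keys_iff)
    then show ?thesis by (subst (asm) prod.remove[of _ j]) auto
  qed
  have "keys (unit_exp j + b) \<subseteq> ?A"
    using Poly_Mapping.keys_add[of "unit_exp j" b] by auto
  note *[OF this]
  also have "(\<Prod>v\<in>?A - {j}. fact (lookup (unit_exp j + b) v) :: 'a) = (\<Prod>v\<in>?A - {j}. fact (lookup b v))"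
    by (intro prod.cong) (auto simp: lookup_add lookup_single when_def)
  also have "fact (lookup (unit_exp j + b) j) = (of_nat (Suc (lookup b j)) * fact (lookup b j) :: 'a)"
    by (simp add: lookup_add)
  also have "\<dots> * (\<Prod>v\<in>?A - {j}. fact (lookup b v)) = of_nat (Suc (lookup b j)) * mon_fact b"
    using *[of b] by (simp only: mult.assoc subset_insertI)
  finally show ?thesis .
qed

lemma poly_value_altdef: "poly_value a p = (\<Sum>m\<in>keys p. lookup p m * mon_value a m)"
  by (simp add: poly_value_def mon_value_def)

lemma poly_value_superset:
  "finite A \<Longrightarrow> keys p \<subseteq> A \<Longrightarrow> poly_value a p = (\<Sum>m\<in>A. lookup p m * mon_value a m)"
  unfolding poly_value_altdef by (rule sum.mono_neutral_left) (auto simp: in_keys_iff)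

lemma poly_value_single: "poly_value a (single m c) = c * mon_value a m"
  by (simp add: poly_value_superset[of "{m}"])

lemma poly_value_add: "poly_value a (p + q) = poly_value a p + poly_value a q"
  using Poly_Mapping.keys_add[of p q]
  by (simp add: poly_value_superset[of "keys p \<union> keys q"] lookup_add algebra_simps sum.distrib)

lemma poly_value_sum: "poly_value a (\<Sum>i\<in>A. p i) = (\<Sum>i\<in>A. poly_value a (p i))"
  by (induction A rule: infinite_finite_induct) (simp_all add: poly_value_add, simp_all add: poly_value_def)

text \<open>The multinomial theorem with denominators cleared. One factor \<open>L\<close> is split
  off; the exponents of \<open>m\<close>, one from each variable removed, add up to the
  degree.\<close>

lemma lookup_linear_form_power:
  fixes L :: "(nat, 'a::{comm_semiring_1,semiring_char_0}) mpoly"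
  assumes L: "L \<in> forms N 1" and "keys m \<subseteq> {..<N}" "mon_degree m = n"
  shows "mon_fact m * lookup (L ^ n) m = fact n * mon_value (\<lambda>v. lookup L (unit_exp v)) m"
  using assms(2,3)
proof (induction n arbitrary: m)
  case 0
  then show ?case by (simp add: mon_degree_eq_0_iff mon_fact_def lookup_one)
next
  case (Suc n)
  define a where "a = (\<lambda>v. lookup L (unit_exp v))"
  have *: "mon_fact m * (a j * lookup (Var j * L ^ n) m) = of_nat (lookup m j) * (fact n * mon_value a m)" for j
  proof (cases "lookup m j > 0")
    case True
    then obtain b where b: "m = unit_exp j + b" by (rule unit_exp_factor)
    have "keys b \<subseteq> keys m" by (auto simp: b in_keys_iff lookup_add)
    then have "mon_fact b * lookup (L ^ n) b = fact n * mon_value a b"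
      using Suc by (simp add: a_def b mon_degree_add)
    then have "of_nat (lookup m j) * a j * (mon_fact b * lookup (L ^ n) b)
        = of_nat (lookup m j) * a j * (fact n * mon_value a b)" by simp
    moreover have lV: "lookup (Var j * L ^ n) (unit_exp j + b) = lookup (L ^ n) b"
      by (simp add: Var_def)
    ultimately show ?thesis
      unfolding b lV mon_fact_unit_exp_add mon_value_add by (simp add: lookup_add mult_ac)
  next
    case False
    then show ?thesis by (simp add: lookup_Var_mult_0)
  qed
  have "L ^ Suc n = (\<Sum>j<N. const (a j) * Var j) * L ^ n"
    using linear_form_expand[OF L] by (simp add: a_def)
  then have "lookup (L ^ Suc n) m = (\<Sum>j<N. a j * lookup (Var j * L ^ n) m)"
    by (simp only: sum_distrib_right lookup_sum mult.assoc lookup_const_mult)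
  then have "mon_fact m * lookup (L ^ Suc n) m = (\<Sum>j<N. of_nat (lookup m j) * (fact n * mon_value a m))"
    by (simp only: sum_distrib_left *)
  also have "\<dots> = of_nat (mon_degree m) * (fact n * mon_value a m)"
    using Suc.prems(1) by (simp add: mon_degree_altdef[of "{..<N}"] sum_distrib_right)
  finally show ?case
    using Suc.prems(2) unfolding a_def by (simp add: algebra_simps)
qed

text \<open>
  The entry in row \<open>i\<close> and column \<open>j\<close> is the value at \<open>H\<close> of the differential operator
  \<open>dual_mon d i \<cdot> x\<^sub>j\<close>, so this is a minor of the catalecticant of \<open>H\<close> of type \<open>(d - 1, 1)\<close>.
\<close>

definition catalecticant :: "nat \<Rightarrow> (nat, complex) mpoly \<Rightarrow> complex mat" where
  "catalecticant d H = mat (d + 2) (d + 2)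
     (\<lambda>(i, j). mon_fact (dual_mon d i + unit_exp j) * lookup H (dual_mon d i + unit_exp j))"

text \<open>The Leibniz expansion of the minor as a polynomial in variables indexed by monomials,
  the kind of equation that \<open>proj_closure\<close> tests.\<close>

definition catalecticant_det :: "nat \<Rightarrow> (nat \<Rightarrow>\<^sub>0 nat, complex) mpoly" where
  "catalecticant_det d = (\<Sum>\<sigma> | \<sigma> permutes {0..<d + 2}.
     single (\<Sum>i = 0..<d + 2. unit_exp (dual_mon d i + unit_exp (\<sigma> i)))
       (signof \<sigma> * (\<Prod>i = 0..<d + 2. mon_fact (dual_mon d i + unit_exp (\<sigma> i)))))"

lemma poly_value_catalecticant_det:
  "poly_value (lookup H) (catalecticant_det d) = det (catalecticant d H)"
proof -
  have "catalecticant d H \<in> carrier_mat (d + 2) (d + 2)" by (simp add: catalecticant_def)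
  moreover have "poly_value (lookup H) (catalecticant_det d) = (\<Sum>\<sigma> | \<sigma> permutes {0..<d + 2}.
      signof \<sigma> * (\<Prod>i = 0..<d + 2. catalecticant d H $$ (i, \<sigma> i)))"
    unfolding catalecticant_det_def poly_value_sum poly_value_single mon_value_sum mon_value_unit_exp
      mult.assoc prod.distrib[symmetric]
  proof (intro sum.cong arg_cong2[of _ _ _ _ "(*)"] prod.cong refl)
    fix \<sigma> i assume "\<sigma> \<in> {\<sigma>. \<sigma> permutes {0..<d + 2}}" and i: "i \<in> {0..<d + 2}"
    then have "\<sigma> i \<in> {0..<d + 2}" by (simp add: permutes_in_image del: atLeastLessThan_iff)
    then show "mon_fact (dual_mon d i + unit_exp (\<sigma> i)) * lookup H (dual_mon d i + unit_exp (\<sigma> i))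
        = catalecticant d H $$ (i, \<sigma> i)"
      using i by (simp add: catalecticant_def)
  qed
  ultimately show ?thesis by (simp add: det_def')
qed

lemma homogeneous_sum:
  fixes p :: "'i \<Rightarrow> ('v, 'a::comm_monoid_add) mpoly"
  shows "(\<And>i. i \<in> A \<Longrightarrow> homogeneous k (p i)) \<Longrightarrow> homogeneous k (\<Sum>i\<in>A. p i)"
proof (induction A rule: infinite_finite_induct)
  case (insert i A)
  then show ?case
    using Poly_Mapping.keys_add[of "p i" "\<Sum>i\<in>A. p i"] by (auto simp: homogeneous_def)
qed (auto simp: homogeneous_def)

lemma homogeneous_catalecticant_det: "homogeneous (d + 2) (catalecticant_det d)"
  unfolding catalecticant_det_def
  by (intro homogeneous_sum) (auto simp: homogeneous_def mon_degree_sum mon_degree_add)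

lemma catalecticant_wild_form:
  assumes d: "d \<ge> 3"
  shows "catalecticant d (wild_form d) = 1\<^sub>m (d + 2)"
proof (rule eq_matI)
  fix i j assume "i < dim_row (1\<^sub>m (d + 2))" "j < dim_col (1\<^sub>m (d + 2))"
  then have i: "i < d + 2" and j: "j < d + 2" by simp_all
  have "mon_fact (dual_mon d i + unit_exp j) * lookup (wild_form d) (dual_mon d i + unit_exp j)
      = (if i = j then 1 else 0)"
  proof (cases "i = j")
    case True
    then have eq: "dual_mon d i + unit_exp j = wild_mon d (dual_index d i)"
      using dual_mon_eq_wild_mon_iff[OF d i j dual_index_less[OF d]] by blast
    show ?thesis
      unfolding eq lookup_wild_form[OF dual_index_less[OF d]] mon_fact_def
        prod_fact_wild_mon[OF dual_index_less[OF d]] using True by simp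
  next
    case False
    then show ?thesis using lookup_wild_form_dual_mon[OF d i j] by simp
  qed
  then show "catalecticant d (wild_form d) $$ (i, j) = 1\<^sub>m (d + 2) $$ (i, j)"
    using i j by (simp add: catalecticant_def)
qed (simp_all add: catalecticant_def)

text \<open>Each \<open>d\<close>-th power contributes a matrix of rank at most one, so the
  catalecticant factors through dimension \<open>r\<close>; padded to square shape, the second
  factor has a zero row.\<close>

lemma det_catalecticant_power_sum:
  assumes d: "d \<ge> 3" and L: "\<And>i. i < r \<Longrightarrow> L i \<in> forms (d + 2) 1" and r: "r < d + 2"
  shows "det (catalecticant d (\<Sum>l<r. const (c l) * L l ^ d)) = 0"
proof -
  let ?N = "d + 2"
  define a where "a = (\<lambda>l v. lookup (L l) (unit_exp v))"
  define A where "A = mat ?N ?N (\<lambda>(i, l). if l < r then c l * fact d * mon_value (a l) (dual_mon d i) else 0)"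
  define B where "B = mat ?N ?N (\<lambda>(l, j). if l < r then a l j else 0)"
  have carrier: "A \<in> carrier_mat ?N ?N" "B \<in> carrier_mat ?N ?N" by (simp_all add: A_def B_def)
  have "catalecticant d (\<Sum>l<r. const (c l) * L l ^ d) = A * B"
  proof (rule eq_matI)
    fix i j assume "i < dim_row (A * B)" "j < dim_col (A * B)"
    then have i: "i < ?N" and j: "j < ?N" by (simp_all add: A_def B_def)
    let ?m = "dual_mon d i + unit_exp j"
    have m: "keys ?m \<subseteq> {..<?N}" "mon_degree ?m = d"
      using dual_mon_forms[OF d i] Poly_Mapping.keys_add[of "dual_mon d i" "unit_exp j"] j d
      by (auto simp: mon_degree_add)
    have "mon_fact ?m * lookup (\<Sum>l<r. const (c l) * L l ^ d) ?m
        = (\<Sum>l<r. c l * (mon_fact ?m * lookup (L l ^ d) ?m))"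
      by (simp only: lookup_sum lookup_const_mult sum_distrib_left mult.left_commute)
    also have "\<dots> = (\<Sum>l<r. c l * (fact d * mon_value (a l) ?m))"
      by (intro sum.cong refl) (simp add: a_def lookup_linear_form_power[OF L m])
    also have "\<dots> = (\<Sum>l<r. A $$ (i, l) * B $$ (l, j))"
      using i j r by (intro sum.cong) (auto simp: A_def B_def mon_value_add)
    also have "\<dots> = (\<Sum>l = 0..<?N. A $$ (i, l) * B $$ (l, j))"
      using i j r by (intro sum.mono_neutral_left) (auto simp: A_def)
    also have "\<dots> = (A * B) $$ (i, j)"
      using i j carrier by (simp add: scalar_prod_def del: sum.op_ivl_Suc)
    finally show "catalecticant d (\<Sum>l<r. const (c l) * L l ^ d) $$ (i, j) = (A * B) $$ (i, j)"
      using i j by (simp add: catalecticant_def)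
  qed (simp_all add: catalecticant_def A_def B_def)
  moreover have "det B = 0"
    using r by (intro det_zero_row[OF carrier(2), of r]) (auto simp: B_def)
  ultimately show ?thesis using det_mult[OF carrier] by simp
qed

lemma wild_form_notin_secant_variety:
  assumes d: "d \<ge> 3" and r: "r < d + 2"
  shows "wild_form d \<notin> secant_variety (d + 2) d r"
proof
  assume "wild_form d \<in> secant_variety (d + 2) d r"
  moreover have "poly_value (lookup H) (catalecticant_det d) = 0"
    if "H \<in> veronese_spans (d + 2) d r" for H
    using that det_catalecticant_power_sum[OF d _ r]
    by (auto simp: veronese_spans_def poly_value_catalecticant_det)
  ultimately have "poly_value (lookup (wild_form d)) (catalecticant_det d) = 0"
    using homogeneous_catalecticant_det[of d] by (auto simp: secant_variety_def proj_closure_def)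
  then show False
    by (simp add: poly_value_catalecticant_det catalecticant_wild_form[OF d] del: One_nat_def)
qed

section \<open>Border rank at most \<open>d + 2\<close>\<close>

lemma Var_power: "Var i ^ n = (single (single i n) 1 :: ('v, 'a::semiring_1) mpoly)"
  by (induction n) (simp_all add: Var_def mult_single flip: single_add)

section \<open>Roots of unity and their orthogonality\<close>

definition root1 :: "nat \<Rightarrow> complex" where
  "root1 d = cis (2 * pi / real d)"

lemma root1_power_eq_1: "d > 0 \<Longrightarrow> root1 d ^ d = 1"
  by (simp add: root1_def DeMoivre)

lemma root1_power_inj:
  assumes "root1 d ^ m = root1 d ^ n" "m < d" "n < d"
  shows "m = n"
proof -
  have "inj_on (\<lambda>k. cis (2 * pi * real k / real d)) {..<d}"
    using bij_betw_roots_unity[of d] assms by (simp add: bij_betw_def)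
  moreover have "cis (2 * pi * real m / real d) = cis (2 * pi * real n / real d)"
    using assms(1) by (simp add: root1_def DeMoivre mult_ac)
  ultimately show ?thesis using assms by (auto dest: inj_onD)
qed

lemma sum_powers_root_of_unity:
  fixes z :: complex
  assumes "z ^ d = 1" "z \<noteq> 1"
  shows "(\<Sum>i<d. z ^ i) = 0"
  using assms by (simp add: sum_gp_strict)

lemma sum_root1_powers:
  assumes d: "d > 0" and m: "m \<le> d"
  shows "(\<Sum>i<d. root1 d ^ (i * m)) = (if m = 0 \<or> m = d then of_nat d else 0)"
proof (cases "m = 0 \<or> m = d")
  case True
  moreover have "root1 d ^ (i * d) = 1" for i
    by (simp add: mult.commute[of i d] power_mult root1_power_eq_1[OF d])
  ultimately show ?thesis by auto
next
  case False
  then have "root1 d ^ m \<noteq> 1" using root1_power_inj[of d m 0] m by auto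
  moreover have "(root1 d ^ m) ^ d = 1"
    using root1_power_eq_1[OF d] by (metis mult.commute power_mult power_one)
  ultimately have "(\<Sum>i<d. (root1 d ^ m) ^ i) = 0" by (intro sum_powers_root_of_unity)
  then show ?thesis using False by (simp add: mult.commute[of _ m] power_mult)
qed

lemma root1_orthogonality:
  assumes "m < d" "n < d"
  shows "(\<Sum>i<d. root1 d ^ (i * m) * inverse (root1 d) ^ (i * n)) = (if n = m then of_nat d else 0)"
proof -
  have [simp]: "root1 d \<noteq> 0" by (simp add: root1_def)
  define z where "z = root1 d ^ m * inverse (root1 d) ^ n"
  have sum: "(\<Sum>i<d. root1 d ^ (i * m) * inverse (root1 d) ^ (i * n)) = (\<Sum>i<d. z ^ i)"
    by (simp add: z_def power_mult_distrib mult.commute[of _ m] mult.commute[of _ n] power_mult)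
  show ?thesis
  proof (cases "n = m")
    case True
    then have "z = 1" by (simp add: z_def power_inverse)
    then show ?thesis using sum True by simp
  next
    case False
    then have "z \<noteq> 1"
      using root1_power_inj[of d m n] assms by (auto simp: z_def field_simps power_inverse)
    moreover have "z ^ d = (root1 d ^ d) ^ m * inverse ((root1 d ^ d) ^ n)"
      by (simp add: z_def power_mult_distrib power_inverse flip: power_mult) (simp add: mult.commute)
    then have "z ^ d = 1" using root1_power_eq_1[of d] assms by simp
    ultimately show ?thesis using sum False sum_powers_root_of_unity[of z d] by simp
  qed
qed

definition base_form :: "nat \<Rightarrow> nat \<Rightarrow> (nat, complex) mpoly" where
  "base_form d i = const (root1 d ^ i) * Var (Suc d) + Var d"

text \<open>The forms \<open>X_i\<close>: an inverse discrete Fourier transform of the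
  \<open>x_k\<close>, in reversed order because \<open>base_form_power\<close> counts powers of
  \<open>v\<close>. The factor \<open>1/d\<close> normalizes the transform, and \<open>1/d!\<close>
  turns binomial coefficients into those of \<open>wild_form d\<close>.\<close>

definition tangent_form :: "nat \<Rightarrow> nat \<Rightarrow> (nat, complex) mpoly" where
  "tangent_form d i = const (1 / (of_nat d * fact d)) *
     (\<Sum>n<d. const (inverse (root1 d) ^ (i * n)) * Var (d - 1 - n))"

lemma sum_root1_tangent_form:
  assumes "m < d"
  shows "(\<Sum>i<d. const (root1 d ^ (i * m)) * tangent_form d i) = const (1 / fact d) * Var (d - 1 - m)"
proof -
  let ?c = "1 / (of_nat d * fact d) :: complex"
  have "(\<Sum>i<d. const (root1 d ^ (i * m)) * tangent_form d i)
      = (\<Sum>i<d. \<Sum>n<d. const (?c * (root1 d ^ (i * m) * inverse (root1 d) ^ (i * n))) * Var (d - 1 - n))"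
    unfolding tangent_form_def sum_distrib_left by (simp only: const_mult mult_ac)
  also have "\<dots> = (\<Sum>n<d. \<Sum>i<d. const (?c * (root1 d ^ (i * m) * inverse (root1 d) ^ (i * n))) * Var (d - 1 - n))"
    by (rule sum.swap)
  also have "\<dots> = (\<Sum>n<d. const (?c * (\<Sum>i<d. root1 d ^ (i * m) * inverse (root1 d) ^ (i * n))) * Var (d - 1 - n))"
    by (simp only: sum_distrib_left const_sum sum_distrib_right)
  also have "\<dots> = (\<Sum>n<d. if n = m then const (1 / fact d) * Var (d - 1 - n) else 0)"
    using assms by (intro sum.cong) (auto simp: root1_orthogonality)
  also have "\<dots> = const (1 / fact d) * Var (d - 1 - m)"
    using assms by (simp add: sum.delta)
  finally show ?thesis .
qed

lemma base_form_power:
  "base_form d i ^ n = (\<Sum>m\<le>n. const (of_nat (n choose m) * root1 d ^ (i * m)) *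
     (Var (Suc d) ^ m * Var d ^ (n - m)))"
  unfolding base_form_def binomial_ring
  by (simp only: const_mult const_of_nat const_power[symmetric] power_mult_distrib
      power_mult[symmetric] mult_ac)

text \<open>Summing over the roots of unity kills every mixed term; only the exponents
  \<open>0\<close> and \<open>d\<close> of \<open>v\<close> survive.\<close>

lemma sum_base_form_powers:
  assumes d: "d > 0"
  shows "(\<Sum>i<d. base_form d i ^ d) = const (of_nat d) * (Var d ^ d + Var (Suc d) ^ d)"
proof -
  have "(\<Sum>i<d. base_form d i ^ d) = (\<Sum>m\<le>d. \<Sum>i<d. const (of_nat (d choose m) * root1 d ^ (i * m)) *
     (Var (Suc d) ^ m * Var d ^ (d - m)))"
    unfolding base_form_power by (rule sum.swap)
  also have "\<dots> = (\<Sum>m\<le>d. const (of_nat (d choose m) * (\<Sum>i<d. root1 d ^ (i * m))) *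
     (Var (Suc d) ^ m * Var d ^ (d - m)))"
    by (simp only: sum_distrib_left const_sum sum_distrib_right)
  also have "\<dots> = (\<Sum>m\<in>{0, d}. const (of_nat (d choose m) * (\<Sum>i<d. root1 d ^ (i * m))) *
     (Var (Suc d) ^ m * Var d ^ (d - m)))"
    using sum_root1_powers[OF d] by (intro sum.mono_neutral_right) auto
  also have "\<dots> = const (of_nat d) * (Var d ^ d + Var (Suc d) ^ d)"
    using d sum_root1_powers[OF d, of d] by (simp add: algebra_simps)
  finally show ?thesis .
qed

text \<open>After binomial expansion the sum over \<open>i\<close> is taken first; Fourier inversion
  turns it into a single variable for each power of \<open>v\<close>.\<close>

lemma sum_tangent_base_form:
  assumes d: "d > 0"
  shows "const (of_nat d) * (\<Sum>i<d. tangent_form d i * base_form d i ^ (d - 1)) = wild_form d"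
proof -
  define c :: "nat \<Rightarrow> complex" where "c m = of_nat d * of_nat ((d - 1) choose m) / fact d" for m
  have c: "c m = 1 / (fact (d - 1 - m) * fact m)" if "m < d" for m
  proof -
    have "fact d = (of_nat d * fact (d - 1) :: complex)" using d by (rule fact_reduce)
    then show ?thesis
      using that d binomial_fact[of m "d - 1", where ?'a = complex] by (simp add: c_def field_simps)
  qed
  let ?y = "\<lambda>m. Var (Suc d) ^ m * Var d ^ (d - 1 - m) :: (nat, complex) mpoly"
  have "{..d - 1} = {..<d}" using d by auto
  then have "const (of_nat d) * (\<Sum>i<d. tangent_form d i * base_form d i ^ (d - 1))
      = (\<Sum>i<d. \<Sum>m<d. const (of_nat d) * (const (of_nat ((d - 1) choose m)) *
          ((const (root1 d ^ (i * m)) * tangent_form d i) * ?y m)))"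
    unfolding base_form_power sum_distrib_left by (simp only: const_mult mult_ac)
  also have "\<dots> = (\<Sum>m<d. \<Sum>i<d. const (of_nat d) * (const (of_nat ((d - 1) choose m)) *
          ((const (root1 d ^ (i * m)) * tangent_form d i) * ?y m)))"
    by (rule sum.swap)
  also have "\<dots> = (\<Sum>m<d. const (of_nat d) * (const (of_nat ((d - 1) choose m)) *
          ((\<Sum>i<d. const (root1 d ^ (i * m)) * tangent_form d i) * ?y m)))"
    by (simp only: sum_distrib_left sum_distrib_right)
  also have "\<dots> = (\<Sum>m<d. const (c m) * (Var (d - 1 - m) * ?y m))"
    by (intro sum.cong refl) (simp add: sum_root1_tangent_form c_def const_mult[symmetric] mult.assoc[symmetric])
  also have "\<dots> = (\<Sum>m<d. single (wild_mon d (d - 1 - m)) (c m))"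
    unfolding Var_power by (intro sum.cong) (simp_all add: Var_def const_def mult_single wild_mon_def add_ac)
  also have "\<dots> = (\<Sum>k<d. single (wild_mon d k) (c (d - 1 - k)))"
    by (rule sum.reindex_bij_witness[of _ "\<lambda>k. d - 1 - k" "\<lambda>k. d - 1 - k"]) auto
  also have "\<dots> = wild_form d"
    unfolding wild_form_def by (intro sum.cong) (auto simp: c)
  finally show ?thesis .
qed

text \<open>The coefficient of \<open>e^k\<close> in the sum of the powers
  \<open>(L_i + e X_i)^d\<close>.\<close>

definition degeneration_coeff :: "nat \<Rightarrow> nat \<Rightarrow> (nat, complex) mpoly" where
  "degeneration_coeff d k =
     const (of_nat (d choose k)) * (\<Sum>i<d. tangent_form d i ^ k * base_form d i ^ (d - k))"

text \<open>That sum without its constant term, divided by \<open>e\<close>. Written as a polynomial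
  in \<open>e\<close>, it makes sense at \<open>e = 0\<close>, where it is
  \<open>wild_form d\<close>.\<close>

definition degeneration :: "nat \<Rightarrow> complex \<Rightarrow> (nat, complex) mpoly" where
  "degeneration d e = (\<Sum>k<d. const (e ^ k) * degeneration_coeff d (Suc k))"

lemma degeneration_coeff_1: "d > 0 \<Longrightarrow> degeneration_coeff d (Suc 0) = wild_form d"
  using sum_tangent_base_form[of d] by (simp add: degeneration_coeff_def)

text \<open>
  As \<open>L\<^sub>0\<^sup>d + \<dots> + L\<^bsub>d-1\<^esub>\<^sup>d = d (u\<^sup>d + v\<^sup>d)\<close> for the forms \<open>L\<^sub>i = u + \<omega>\<^sup>i v\<close>, the sum of the powers of
  \<open>L\<^sub>i + \<epsilon> X\<^sub>i\<close> differs from \<open>\<epsilon> F + O(\<epsilon>\<^sup>2)\<close> by a combination of only two further powers.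
\<close>

lemma degeneration_eq:
  assumes d: "d > 0"
  shows "const e * degeneration d e = (\<Sum>i<d. (const e * tangent_form d i + base_form d i) ^ d)
           - const (of_nat d) * (Var d ^ d + Var (Suc d) ^ d)"
proof -
  let ?t = "\<lambda>k. const (e ^ k) * degeneration_coeff d k"
  have "(\<Sum>i<d. (const e * tangent_form d i + base_form d i) ^ d)
      = (\<Sum>i<d. \<Sum>k\<le>d. const (e ^ k) * (const (of_nat (d choose k)) *
          (tangent_form d i ^ k * base_form d i ^ (d - k))))"
    unfolding binomial_ring
    by (simp add: const_of_nat const_power power_mult_distrib mult_ac)
  also have "\<dots> = (\<Sum>k\<le>d. ?t k)"
    by (subst sum.swap) (simp only: degeneration_coeff_def sum_distrib_left)
  also have "{..d} = {..<Suc d}" by auto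
  also have "(\<Sum>k<Suc d. ?t k) = ?t 0 + (\<Sum>k<d. ?t (Suc k))"
    by (rule sum.lessThan_Suc_shift)
  also have "?t 0 = const (of_nat d) * (Var d ^ d + Var (Suc d) ^ d)"
    using sum_base_form_powers[OF d] by (simp add: degeneration_coeff_def)
  also have "(\<Sum>k<d. ?t (Suc k)) = const e * degeneration d e"
    by (simp only: degeneration_def sum_distrib_left power_Suc const_mult mult.assoc)
  finally show ?thesis by (simp only: add_diff_cancel_left')
qed

lemma perturbed_base_form:
  assumes "i < d"
  shows "const e * tangent_form d i + base_form d i \<in> forms (d + 2) 1"
    and "const e * tangent_form d i + base_form d i \<noteq> 0"
proof -
  show "const e * tangent_form d i + base_form d i \<in> forms (d + 2) 1"
    unfolding tangent_form_def base_form_def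
    by (intro forms_add forms_const_mult forms_sum forms_Var) auto
  have "unit_exp d = unit_exp j \<longleftrightarrow> j = d" for j :: nat
    by (metis lookup_single_eq lookup_single_not_eq nat.distinct(1))
  \<comment> \<open>The forms \<open>X_i\<close> do not involve \<open>u\<close>, so the coefficient
    of \<open>u\<close> stays \<open>1\<close> for every \<open>e\<close>.\<close>
  then have "lookup (const e * tangent_form d i + base_form d i) (unit_exp d) = 1"
    by (auto simp: tangent_form_def base_form_def lookup_add lookup_sum lookup_Var intro!: sum.neutral)
  then show "const e * tangent_form d i + base_form d i \<noteq> 0" by auto
qed

lemma Var_nonzero: "Var i \<noteq> (0 :: ('v, 'a::zero_neq_one) mpoly)"
  by (metis Var_def lookup_single_eq lookup_zero zero_neq_one)

lemma degeneration_in_veronese_spans: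
  assumes d: "d > 0" and e: "e \<noteq> 0" and ne: "degeneration d e \<noteq> 0"
  shows "degeneration d e \<in> veronese_spans (d + 2) d (d + 2)"
proof -
  \<comment> \<open>The last two points, at indices \<open>d\<close> and \<open>d + 1\<close>, are
    \<open>u\<close> and \<open>v\<close>; they remove the constant term.\<close>
  define L where "L i = (if i < d then const e * tangent_form d i + base_form d i else Var i)" for i
  define c where "c i = (if i < d then 1 / e else - of_nat d / e)" for i
  have "degeneration d e = const (1 / e) * (const e * degeneration d e)"
    using e by (simp add: const_mult[symmetric] mult.assoc[symmetric])
  also have "\<dots> = (\<Sum>i<d. const (1 / e) * (const e * tangent_form d i + base_form d i) ^ d)
      + (const (- of_nat d / e) * Var d ^ d + const (- of_nat d / e) * Var (Suc d) ^ d)"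
    unfolding degeneration_eq[OF d]
    by (simp add: sum_distrib_left const_minus const_mult[symmetric] mult.assoc[symmetric] algebra_simps)
  also have "\<dots> = (\<Sum>i<d + 2. const (c i) * L i ^ d)"
    by (simp add: c_def L_def)
  finally have "degeneration d e = (\<Sum>i<d + 2. const (c i) * L i ^ d)" .
  moreover have "L i \<in> forms (d + 2) 1 \<and> L i \<noteq> 0" if "i < d + 2" for i
    using that perturbed_base_form[of i d] forms_Var[of i "d + 2"] by (auto simp: L_def Var_nonzero)
  ultimately show ?thesis
    using ne by (auto simp: veronese_spans_def)
qed

lemma tendsto_lookup_degeneration:
  assumes d: "d > 0"
  shows "((\<lambda>e. lookup (degeneration d e) m) \<longlongrightarrow> lookup (wild_form d) m) (at 0)"
proof -
  have "((\<lambda>e. \<Sum>k<d. e ^ k * lookup (degeneration_coeff d (Suc k)) m) \<longlongrightarrow>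
          (\<Sum>k<d. 0 ^ k * lookup (degeneration_coeff d (Suc k)) m)) (at 0)"
    by (intro tendsto_intros)
  moreover have "(\<Sum>k<d. 0 ^ k * lookup (degeneration_coeff d (Suc k)) m)
      = (\<Sum>k<d. if k = 0 then lookup (wild_form d) m else 0)"
    using degeneration_coeff_1[OF d] by (intro sum.cong) auto
  ultimately show ?thesis
    using d by (simp add: degeneration_def lookup_sum sum.delta)
qed

text \<open>Polynomials in the coefficients are continuous, so an equation satisfied along the
  degeneration for small \<open>e \<noteq> 0\<close> holds in the limit.\<close>

lemma wild_form_in_secant_variety:
  assumes d: "d > 0"
  shows "wild_form d \<in> secant_variety (d + 2) d (d + 2)"
proof -
  \<comment> \<open>\<open>veronese_spans\<close> contains only nonzero vectors, so the degeneration
    must be nonzero near \<open>e = 0\<close>.\<close>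
  have nonzero: "\<forall>\<^sub>F e in at 0. degeneration d e \<noteq> 0"
  proof -
    have "lookup (wild_form d) (wild_mon d 0) \<noteq> 0" using d by (simp add: lookup_wild_form)
    then have "\<forall>\<^sub>F e in at 0. lookup (degeneration d e) (wild_mon d 0) \<noteq> 0"
      using tendsto_imp_eventually_ne tendsto_lookup_degeneration[OF d] by blast
    then show ?thesis by eventually_elim auto
  qed
  have "poly_value (lookup (wild_form d)) P = 0"
    if P: "\<And>H. H \<in> veronese_spans (d + 2) d (d + 2) \<Longrightarrow> poly_value (lookup H) P = 0" for P
  proof -
    have "((\<lambda>e. poly_value (lookup (degeneration d e)) P) \<longlongrightarrow> poly_value (lookup (wild_form d)) P) (at 0)"
      unfolding poly_value_def by (intro tendsto_intros tendsto_lookup_degeneration d)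
    moreover have "\<forall>\<^sub>F e in at 0. poly_value (lookup (degeneration d e)) P = 0"
      using nonzero eventually_neq_at_within[of 0 0 UNIV]
      by eventually_elim (auto intro: P degeneration_in_veronese_spans d)
    ultimately have "((\<lambda>_. 0) \<longlongrightarrow> poly_value (lookup (wild_form d)) P) (at (0::complex))"
      using tendsto_cong by fast
    then show ?thesis
      by (simp add: tendsto_const_iff)
  qed
  then show ?thesis
    using wild_form_in_forms[of d] wild_form_nonzero[OF d]
    by (simp add: secant_variety_def proj_closure_def)
qed

section \<open>Conclusion\<close>

lemma border_rank_wild_form:
  assumes d: "d \<ge> 3"
  shows "border_rank (d + 2) d (wild_form d) = enat (d + 2)"
  unfolding border_rank_def least_rank_def
proof (rule antisym)
  show "Inf (enat ` {r. wild_form d \<in> secant_variety (d + 2) d r}) \<le> enat (d + 2)"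
    using wild_form_in_secant_variety[of d] d by (intro Inf_lower imageI CollectI) simp
  show "enat (d + 2) \<le> Inf (enat ` {r. wild_form d \<in> secant_variety (d + 2) d r})"
    using wild_form_notin_secant_variety[OF d] by (intro Inf_greatest) (force simp: not_le[symmetric])
qed

lemma smoothable_rank_wild_form:
  assumes d: "d \<ge> 3"
  shows "enat (Suc (d + 2)) \<le> smoothable_rank (d + 2) d (wild_form d)"
  unfolding smoothable_rank_def least_rank_def
proof (intro Inf_greatest, elim imageE CollectE exE conjE)
  fix y r I
  assume "zero_dim_scheme (d + 2) r I" "wild_form d \<in> linear_span (d + 2) d I" and y: "y = enat r"
  then have "r > d + 2" using small_scheme_not_apolar[OF d] by blast
  then show "enat (Suc (d + 2)) \<le> y" using y by simp
qed

theorem mainTheorem5: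
  fixes d :: nat
  assumes "d \<ge> 3"
  shows "\<exists>(N::nat) (F :: (nat, complex) mpoly).
           F \<in> forms N d \<and> F \<noteq> 0 \<and> concise N F \<and>
           border_rank N d F = enat N \<and> wild N d F"
proof (intro exI conjI)
  show "wild_form d \<in> forms (d + 2) d" by (rule wild_form_in_forms)
  show "wild_form d \<noteq> 0" using assms by (intro wild_form_nonzero) simp
  show "concise (d + 2) (wild_form d)" by (rule concise_wild_form[OF assms])
  show br: "border_rank (d + 2) d (wild_form d) = enat (d + 2)"
    by (rule border_rank_wild_form[OF assms])
  have "enat (d + 2) < enat (Suc (d + 2))" by simp
  also have "\<dots> \<le> smoothable_rank (d + 2) d (wild_form d)"
    by (rule smoothable_rank_wild_form[OF assms])
  finally show "wild (d + 2) d (wild_form d)"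
    unfolding wild_def br .
qed

end
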